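(* Let $m\in\mathbb{N}$ and let $G$ be a group of type $\mathrm{FP}_m$ with solvable word problem. Then there exists $k\ge 0$, arising as the maximum $k=\max(n_0,\ldots,n_m)$ of a homological connecting vector $(n_0,\ldots,n_m)$ for $G$, such that for every non-zero character $\chi:G\to\mathbb{R}$ the following are equivalent: 1. $\chi\in\Sigma^m(G;\mathbb{Z})$; 2. there exists a chain endomorphism of $\mathbb{Z}G$-complexes $\varphi_q:\mathrm{C}_q(\mathrm{VR}_k(G))\to \mathrm{C}_q(\mathrm{VR}_k(G))$, $q=0,\ldots,m$, extending the identity on $\mathbb{Z}$ with $v(\varphi_q(c))-v(c)>0$ for every non-zero $c\in \mathrm{C}_q(\mathrm{VR}_k(G))$, $q=0,\ldots,m$; 3. the homological Sigma-$m$-criterion algorithm (described in the context), with input $G$, $(n_0,\ldots,n_m)$ and $\chi$, terminates with output ``yes''.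
   Context: Finitely generated groups $G$ carry the word metric $d(g,h)=l(g^{-1}h)$ with respect to a finite generating set; subsets carry the subspace metric. For a metric space $X$, $k\ge 0$, $q\ge 0$, put $\Delta^q_k(X)=\{(x_0,\ldots,x_q)\in X^{q+1}\mid d(x_i,x_j)\le k \text{ for all } i,j\}$ and $\Delta^q_k=\Delta^q_k(G)$. The Vietoris--Rips complex $\mathrm{VR}_k(X)$ is the simplicial set with $q$-simplices $\Delta^q_k(X)$ (faces omit an entry, degeneracies repeat an entry). Its chain complex is $\mathrm{C}_q(\mathrm{VR}_k(X))=\mathbb{Z}[\Delta^q_k(X)]$ with $\partial_q(x_0,\ldots,x_q)=\sum_{i=0}^q(-1)^i(x_0,\ldots,\widehat{x_i},\ldots,x_q)$. For $X=G$ this is a complex of free $\mathbb{Z}G$-modules via diagonal left multiplication, with augmentation $\epsilon:\mathbb{Z}[G]\to\mathbb{Z}$, $g\mapsto 1$; a chain endomorphism $\varphi$ extends the identity on $\mathbb{Z}$ if $\epsilon\circ\varphi_0=\epsilon$. For $i\le j$, $\tilde{\mathrm{H}}_q(\mathrm{VR}_i(X))$ vanishes in $\tilde{\mathrm{H}}_q(\mathrm{VR}_j(X))$ if the inclusion-induced map is zero. $X$ is of type $\mathrm{FP}_m$ if for each $q=0,\ldots,m-1$ and every $i$ there is $j\ge i$ such that $\tilde{\mathrm{H}}_q(\mathrm{VR}_i(X))$ vanishes in $\tilde{\mathrm{H}}_q(\mathrm{VR}_j(X))$. $G$ is of type $\mathrm{FP}_m$ if $(G,d)$ is. A vector $(n_0,\ldots,n_m)$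 is a homological connecting vector for $G$ if $\tilde{\mathrm{H}}_q(\mathrm{VR}_{n_q}(G))$ vanishes in $\tilde{\mathrm{H}}_q(\mathrm{VR}_{n_{q+1}}(G))$ for $q=0,\ldots,m-1$. A character is a homomorphism $\chi:G\to(\mathbb{R},+)$. For $L\in\mathbb{R}$, $G_L=\{g\in G\mid \chi(g)\ge L\}$, and $G_\chi=G_0$. By definition $\chi\in\Sigma^m(G;\mathbb{Z})$ iff $(G_\chi,d)$ is of type $\mathrm{FP}_m$. The valuation is $v(g_0,\ldots,g_q)=\min_i\chi(g_i)$, $v(\sum_\sigma n_\sigma\sigma)=\min\{v(\sigma)\mid n_\sigma\neq0\}$, $v(0)=+\infty$. Homological Sigma-$m$-criterion algorithm. Input: $G$ of type $\mathrm{FP}_m$, a homological connecting vector $(n_0,\ldots,n_m)$ for $G$, a non-zero character $\chi$. Put $n:=\max(n_0,\ldots,n_m)$. Pick $t\in G$ with $\chi(t)>0$. Define the $\mathbb{Z}G$-homomorphism $\varphi_0:\mathbb{Z}[G]\to\mathbb{Z}[G]$ by $1_G\mapsto t$. For $q=1,\ldots,m$ and for each $\bar x=(1_G,g_1,\ldots,g_q)\in\Delta^q_n$: search for $\bar y\in\mathbb{Z}[\Delta^q_n\cap G_{\chi(t)+v(\bar x)}^{q+1}]$ with $\partial_q\bar y=\varphi_{q-1}(\partial_q\bar x)$; if the search terminates (finds such a $\bar y$), set $\varphi_q(\bar x):=\bar y$ (extended $\mathbb{Z}G$-linearly), otherwise return ``maybe''. If all searches succeed return ``yes''. The search is an enumeration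 of the countably many candidates, made possible by a solution of the word problem. The choices of $t$ and of the $\bar y$ are guesses: output ``yes'' means that some run, with suitable choices and sufficient search time, returns ``yes''. *)

theory Defs
  imports "HOL-Algebra.Free_Abelian_Groups" "HOL-Library.Nat_Bijection" "HOL-Library.Extended_Real"
begin

section \<open>Word metric and word problem\<close>

definition word_length :: "('a, 'b) monoid_scheme \<Rightarrow> 'a set \<Rightarrow> 'a \<Rightarrow> nat" where
  "word_length G S g =
     (LEAST n. \<exists>ws. length ws = n \<and> set ws \<subseteq> S \<union> (\<lambda>s. inv\<^bsub>G\<^esub> s) ` S
                  \<and> foldr (\<otimes>\<^bsub>G\<^esub>) ws \<one>\<^bsub>G\<^esub> = g)"

definition word_dist :: "('a, 'b) monoid_scheme \<Rightarrow> 'a set \<Rightarrow> 'a \<Rightarrow> 'a \<Rightarrow> real" where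
  "word_dist G S g h = real (word_length G S (inv\<^bsub>G\<^esub> g \<otimes>\<^bsub>G\<^esub> h))"

text \<open>
  Total recursive functions of a given arity (Kleene: minimisation is applied to regular
  functions only). The values on lists of any other length are irrelevant.
\<close>

inductive recursive_fun :: "nat \<Rightarrow> (nat list \<Rightarrow> nat) \<Rightarrow> bool" where
  zero: "recursive_fun k (\<lambda>xs. 0)"
| succ: "recursive_fun 1 (\<lambda>xs. Suc (xs ! 0))"
| proj: "i < k \<Longrightarrow> recursive_fun k (\<lambda>xs. xs ! i)"
| comp: "recursive_fun (length gs) f \<Longrightarrow> \<forall>g\<in>set gs. recursive_fun k g
           \<Longrightarrow> recursive_fun k (\<lambda>xs. f (map (\<lambda>g. g xs) gs))"
| prim_rec: "recursive_fun k f \<Longrightarrow> recursive_fun (Suc (Suc k)) g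
           \<Longrightarrow> recursive_fun (Suc k)
                 (\<lambda>xs. rec_nat (f (tl xs)) (\<lambda>n r. g (n # r # tl xs)) (hd xs))"
| minimise: "recursive_fun (Suc k) f \<Longrightarrow> \<forall>xs. length xs = k \<longrightarrow> (\<exists>z. f (z # xs) = 0)
           \<Longrightarrow> recursive_fun k (\<lambda>xs. LEAST z. f (z # xs) = 0)"

definition recursive_set :: "nat set \<Rightarrow> bool" where
  "recursive_set A \<longleftrightarrow> (\<exists>f. recursive_fun 1 f \<and> (\<forall>n. f [n] = of_bool (n \<in> A)))"

text \<open>The number \<open>2 * i\<close> stands for the \<open>i\<close>-th generator, \<open>2 * i + 1\<close> for its inverse.\<close>

definition letter :: "('a, 'b) monoid_scheme \<Rightarrow> 'a list \<Rightarrow> nat \<Rightarrow> 'a" where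
  "letter G gs c = (if even c then gs ! (c div 2) else inv\<^bsub>G\<^esub> (gs ! (c div 2)))"

definition word_problem :: "('a, 'b) monoid_scheme \<Rightarrow> 'a list \<Rightarrow> nat list set" where
  "word_problem G gs =
     {w. (\<forall>c\<in>set w. c < 2 * length gs) \<and> foldr (\<otimes>\<^bsub>G\<^esub>) (map (letter G gs) w) \<one>\<^bsub>G\<^esub> = \<one>\<^bsub>G\<^esub>}"

definition solvable_word_problem :: "('a, 'b) monoid_scheme \<Rightarrow> 'a set \<Rightarrow> bool" where
  "solvable_word_problem G S \<longleftrightarrow>
     (\<exists>gs. set gs = S \<and> recursive_set (list_encode ` word_problem G gs))"

section \<open>Vietoris--Rips chains and reduced homology\<close>

text \<open>
  A \<open>q\<close>-simplex is a list of length \<open>q + 1\<close>; a chain is a finitely supported integer-valued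
  function on lists. The set \<open>simplices X d q k\<close> is \<open>\<Delta>\<^sup>q\<^sub>k(X)\<close>.
\<close>

type_synonym 'a vr_chain = "'a list \<Rightarrow>\<^sub>0 int"

definition simplices :: "'a set \<Rightarrow> ('a \<Rightarrow> 'a \<Rightarrow> real) \<Rightarrow> nat \<Rightarrow> real \<Rightarrow> 'a list set" where
  "simplices X d q k =
     {\<sigma>. length \<sigma> = Suc q \<and> set \<sigma> \<subseteq> X \<and> (\<forall>i\<le>q. \<forall>j\<le>q. d (\<sigma> ! i) (\<sigma> ! j) \<le> k)}"

abbreviation vr_group ::
    "'a set \<Rightarrow> ('a \<Rightarrow> 'a \<Rightarrow> real) \<Rightarrow> nat \<Rightarrow> real \<Rightarrow> 'a vr_chain monoid" where
  "vr_group X d q k \<equiv> free_Abelian_group (simplices X d q k)"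

abbreviation vr_chains :: "'a set \<Rightarrow> ('a \<Rightarrow> 'a \<Rightarrow> real) \<Rightarrow> nat \<Rightarrow> real \<Rightarrow> 'a vr_chain set" where
  "vr_chains X d q k \<equiv> carrier (vr_group X d q k)"

definition face :: "nat \<Rightarrow> 'a list \<Rightarrow> 'a list" where
  "face i \<sigma> = take i \<sigma> @ drop (Suc i) \<sigma>"

definition boundary :: "nat \<Rightarrow> 'a vr_chain \<Rightarrow> 'a vr_chain" where
  "boundary q = frag_extend (\<lambda>\<sigma>. \<Sum>i\<le>q. frag_cmul ((-1) ^ i) (frag_of (face i \<sigma>)))"

definition augmentation :: "'a vr_chain \<Rightarrow> int" where
  "augmentation c = (\<Sum>\<sigma>\<in>Poly_Mapping.keys c. Poly_Mapping.lookup c \<sigma>)"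

definition cycles :: "'a set \<Rightarrow> ('a \<Rightarrow> 'a \<Rightarrow> real) \<Rightarrow> nat \<Rightarrow> real \<Rightarrow> 'a vr_chain set" where
  "cycles X d q k =
     {c \<in> vr_chains X d q k. if q = 0 then augmentation c = 0 else boundary q c = 0}"

definition boundaries :: "'a set \<Rightarrow> ('a \<Rightarrow> 'a \<Rightarrow> real) \<Rightarrow> nat \<Rightarrow> real \<Rightarrow> 'a vr_chain set" where
  "boundaries X d q k = boundary (Suc q) ` vr_chains X d (Suc q) k"

definition reduced_homology ::
    "'a set \<Rightarrow> ('a \<Rightarrow> 'a \<Rightarrow> real) \<Rightarrow> nat \<Rightarrow> real \<Rightarrow> 'a vr_chain set monoid" where
  "reduced_homology X d q k =
     ((vr_group X d q k)\<lparr>carrier := cycles X d q k\<rparr>) Mod boundaries X d q k"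

text \<open>
  The map induced by the inclusion into scale \<open>j\<close> sends the class \<open>c + B\<^sub>i\<close> to
  \<open>c + B\<^sub>j = B\<^sub>j + (c + B\<^sub>i)\<close>, as \<open>B\<^sub>i \<subseteq> B\<^sub>j\<close>.
\<close>

definition inclusion_induced ::
    "'a set \<Rightarrow> ('a \<Rightarrow> 'a \<Rightarrow> real) \<Rightarrow> nat \<Rightarrow> real \<Rightarrow> 'a vr_chain set \<Rightarrow> 'a vr_chain set" where
  "inclusion_induced X d q j A = boundaries X d q j <#>\<^bsub>vr_group X d q j\<^esub> A"

definition homology_vanishes ::
    "'a set \<Rightarrow> ('a \<Rightarrow> 'a \<Rightarrow> real) \<Rightarrow> nat \<Rightarrow> real \<Rightarrow> real \<Rightarrow> bool" where
  "homology_vanishes X d q i j \<longleftrightarrow>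
     i \<le> j \<and> (\<forall>A \<in> carrier (reduced_homology X d q i).
                inclusion_induced X d q j A = \<one>\<^bsub>reduced_homology X d q j\<^esub>)"

definition type_FP :: "nat \<Rightarrow> 'a set \<Rightarrow> ('a \<Rightarrow> 'a \<Rightarrow> real) \<Rightarrow> bool" where
  "type_FP m X d \<longleftrightarrow> (\<forall>q<m. \<forall>i\<ge>0. \<exists>j\<ge>i. homology_vanishes X d q i j)"

definition connecting_vector ::
    "('a, 'b) monoid_scheme \<Rightarrow> 'a set \<Rightarrow> nat \<Rightarrow> real list \<Rightarrow> bool" where
  "connecting_vector G S m ns \<longleftrightarrow>
     length ns = Suc m \<and> (\<forall>n\<in>set ns. 0 \<le> n) \<and>
     (\<forall>q<m. homology_vanishes (carrier G) (word_dist G S) q (ns ! q) (ns ! Suc q))"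

section \<open>Characters, Sigma-invariants, valuations\<close>

definition real_add_group :: "real monoid" where
  "real_add_group = \<lparr>carrier = UNIV, monoid.mult = (+), one = 0\<rparr>"

definition superlevel :: "('a, 'b) monoid_scheme \<Rightarrow> ('a \<Rightarrow> real) \<Rightarrow> real \<Rightarrow> 'a set" where
  "superlevel G \<chi> L = {g \<in> carrier G. L \<le> \<chi> g}"

definition Sigma_inv ::
    "('a, 'b) monoid_scheme \<Rightarrow> 'a set \<Rightarrow> nat \<Rightarrow> ('a \<Rightarrow> real) set" where
  "Sigma_inv G S m =
     {\<chi> \<in> hom G real_add_group. type_FP m (superlevel G \<chi> 0) (word_dist G S)}"

definition simplex_val :: "('a \<Rightarrow> real) \<Rightarrow> 'a list \<Rightarrow> real" where
  "simplex_val \<chi> \<sigma> = Min (\<chi> ` set \<sigma>)"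

definition chain_val :: "('a \<Rightarrow> real) \<Rightarrow> 'a vr_chain \<Rightarrow> ereal" where
  "chain_val \<chi> c =
     (if c = 0 then \<infinity> else ereal (Min (simplex_val \<chi> ` Poly_Mapping.keys c)))"

section \<open>The module structure and chain endomorphisms\<close>

definition translate :: "('a, 'b) monoid_scheme \<Rightarrow> 'a \<Rightarrow> 'a vr_chain \<Rightarrow> 'a vr_chain" where
  "translate G g = frag_extend (\<lambda>\<sigma>. frag_of (map (\<lambda>x. g \<otimes>\<^bsub>G\<^esub> x) \<sigma>))"

definition group_ring_act ::
    "('a, 'b) monoid_scheme \<Rightarrow> ('a \<Rightarrow>\<^sub>0 int) \<Rightarrow> 'a vr_chain \<Rightarrow> 'a vr_chain" where
  "group_ring_act G r c = frag_extend (\<lambda>g. translate G g c) r"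

definition ZG_endomorphism ::
    "('a, 'b) monoid_scheme \<Rightarrow> 'a set \<Rightarrow> nat \<Rightarrow> real \<Rightarrow> ('a vr_chain \<Rightarrow> 'a vr_chain) \<Rightarrow> bool" where
  "ZG_endomorphism G S q k f \<longleftrightarrow>
     (let C = vr_group (carrier G) (word_dist G S) q k in
       f \<in> hom C C \<and>
       (\<forall>r \<in> carrier (free_Abelian_group (carrier G)). \<forall>c \<in> carrier C.
          f (group_ring_act G r c) = group_ring_act G r (f c)))"

definition chain_endomorphism ::
    "('a, 'b) monoid_scheme \<Rightarrow> 'a set \<Rightarrow> nat \<Rightarrow> real \<Rightarrow>
      (nat \<Rightarrow> 'a vr_chain \<Rightarrow> 'a vr_chain) \<Rightarrow> bool" where
  "chain_endomorphism G S m k \<phi> \<longleftrightarrow>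
     (\<forall>q\<le>m. ZG_endomorphism G S q k (\<phi> q)) \<and>
     (\<forall>q<m. \<forall>c \<in> vr_chains (carrier G) (word_dist G S) (Suc q) k.
        boundary (Suc q) (\<phi> (Suc q) c) = \<phi> q (boundary (Suc q) c))"

definition extends_identity ::
    "('a, 'b) monoid_scheme \<Rightarrow> 'a set \<Rightarrow> real \<Rightarrow> (nat \<Rightarrow> 'a vr_chain \<Rightarrow> 'a vr_chain) \<Rightarrow> bool" where
  "extends_identity G S k \<phi> \<longleftrightarrow>
     (\<forall>c \<in> vr_chains (carrier G) (word_dist G S) 0 k. augmentation (\<phi> 0 c) = augmentation c)"

section \<open>The criterion algorithm\<close>

definition base_simplices ::
    "('a, 'b) monoid_scheme \<Rightarrow> 'a set \<Rightarrow> nat \<Rightarrow> real \<Rightarrow> 'a list set" where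
  "base_simplices G S q n = {x \<in> simplices (carrier G) (word_dist G S) q n. hd x = \<one>\<^bsub>G\<^esub>}"

text \<open>
  The \<open>\<int>G\<close>-linear extension of values prescribed on the basis of simplices with first
  vertex \<open>\<one>\<close>; every simplex is the translate by its first vertex of such a simplex.
\<close>

definition linear_extension ::
    "('a, 'b) monoid_scheme \<Rightarrow> ('a list \<Rightarrow> 'a vr_chain) \<Rightarrow> 'a vr_chain \<Rightarrow> 'a vr_chain" where
  "linear_extension G f =
     frag_extend (\<lambda>\<sigma>. translate G (hd \<sigma>) (f (map (\<lambda>x. inv\<^bsub>G\<^esub> (hd \<sigma>) \<otimes>\<^bsub>G\<^esub> x) \<sigma>)))"

definition candidates ::
    "('a, 'b) monoid_scheme \<Rightarrow> 'a set \<Rightarrow> ('a \<Rightarrow> real) \<Rightarrow> real \<Rightarrow> 'a \<Rightarrow> nat \<Rightarrow> 'a list \<Rightarrow>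
      'a vr_chain set" where
  "candidates G S \<chi> n t q x =
     carrier (free_Abelian_group
       (simplices (carrier G) (word_dist G S) q n
          \<inter> lists (superlevel G \<chi> (\<chi> t + simplex_val \<chi> x))))"

text \<open>
  A state of the algorithm records the guess \<open>t\<close>, the current degree, the basis simplices of
  that degree still to be treated, and the values found so far.
\<close>

datatype answer = Yes | Maybe

datatype 'a state =
    Start
  | Running (guess: 'a) (deg: nat) (todo: "'a list set") (vals: "nat \<Rightarrow> 'a list \<Rightarrow> 'a vr_chain")
  | Halted answer

text \<open>
  A search runs through the first \<open>N\<close> entries of an enumeration \<open>e\<close> of the candidates and stops
  at the first solution; the bound \<open>N\<close> is the search time, and the freedom in the choice of \<open>e\<close>
  makes the solution a guess.
\<close>

inductive algorithm_step ::
    "('a, 'b) monoid_scheme \<Rightarrow> 'a set \<Rightarrow> nat \<Rightarrow> real list \<Rightarrow> ('a \<Rightarrow> real) \<Rightarrow>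
      'a state \<Rightarrow> 'a state \<Rightarrow> bool"
  for G S m ns \<chi> where
  pick: "t \<in> carrier G \<Longrightarrow> \<chi> t > 0
    \<Longrightarrow> algorithm_step G S m ns \<chi> Start
          (Running t 0 {} ((\<lambda>_ _. 0)(0 := (\<lambda>_. 0)([\<one>\<^bsub>G\<^esub>] := frag_of [t]))))"
| next_degree: "q < m
    \<Longrightarrow> algorithm_step G S m ns \<chi> (Running t q {} \<phi>)
          (Running t (Suc q) (base_simplices G S (Suc q) (Max (set ns))) \<phi>)"
| found: "x \<in> X
    \<Longrightarrow> range e = candidates G S \<chi> (Max (set ns)) t q x
    \<Longrightarrow> find (\<lambda>y. boundary q y = linear_extension G (\<phi> (q - 1)) (boundary q (frag_of x)))
          (map e [0..<N]) = Some y
    \<Longrightarrow> algorithm_step G S m ns \<chi> (Running t q X \<phi>)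
          (Running t q (X - {x}) (\<phi>(q := (\<phi> q)(x := y))))"
| not_found: "x \<in> X
    \<Longrightarrow> range e = candidates G S \<chi> (Max (set ns)) t q x
    \<Longrightarrow> find (\<lambda>y. boundary q y = linear_extension G (\<phi> (q - 1)) (boundary q (frag_of x)))
          (map e [0..<N]) = None
    \<Longrightarrow> algorithm_step G S m ns \<chi> (Running t q X \<phi>) (Halted Maybe)"
| finish: "algorithm_step G S m ns \<chi> (Running t m {} \<phi>) (Halted Yes)"

definition algorithm_outputs ::
    "('a, 'b) monoid_scheme \<Rightarrow> 'a set \<Rightarrow> nat \<Rightarrow> real list \<Rightarrow> ('a \<Rightarrow> real) \<Rightarrow> answer \<Rightarrow> bool" where
  "algorithm_outputs G S m ns \<chi> a \<longleftrightarrow> (algorithm_step G S m ns \<chi>)\<^sup>*\<^sup>* Start (Halted a)"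

end

theory Submission
  imports Defs
begin

text \<open>
  Choose \<open>\<mu>\<close> such that for \<open>q < m\<close> all \<open>q\<close>-cycles of scale \<open>i\<close> bound at scale \<open>\<mu> i\<close>, and put
  \<open>n\<^sub>0 = 1\<close>, \<open>n\<^bsub>q+1\<^esub> = \<mu>\<^bsup>q+1\<^esup>(n\<^sub>q)\<close>: between \<open>n\<^sub>q\<close> and \<open>n\<^bsub>q+1\<^esub>\<close> there is room for a chain homotopy up to
  degree \<open>q\<close>. Equivariant maps lose or gain a bounded amount of valuation, because there are
  finitely many orbits of simplices.

  If \<open>\<chi>\<close> lies in \<open>\<Sigma>\<^sup>m\<close>, a cycle of \<open>G\<^sub>L\<close> at scale \<open>n\<^sub>q\<close> bounds in \<open>G\<^sub>L\<close> at some large scale;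
  retracting to the scales \<open>n\<^sub>q\<close> makes it bound in \<open>G\<^bsub>L-D\<^esub>\<close> at scale \<open>n\<^bsub>q+1\<^esub>\<close>, with a constant \<open>D\<close>. Hence
  \<open>1 \<mapsto> t\<^sup>r\<close> extends to a chain endomorphism with gain at least \<open>r\<chi>(t) - mD\<close>, and a homotopy along
  the powers of a generator \<open>t\<close> turns it into one which starts with \<open>1 \<mapsto> t\<close> and has the gain \<open>\<chi>(t)\<close>
  required by the algorithm.

  Conversely, let \<open>\<phi>\<close> raise valuations and let \<open>z\<close> be a cycle of \<open>G\<^sub>0\<close> at any scale. Retract \<open>z\<close>
  to scale \<open>k\<close> and push it back into \<open>G\<^sub>0\<close> by a power of \<open>\<phi>\<close>; it bounds in \<open>G\<close>, hence after a
  further power of \<open>\<phi>\<close> also in \<open>G\<^sub>0\<close>. The homotopies to the identity from \<open>\<phi>\<close> and from the retraction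
  followed by the power of \<open>\<phi>\<close> are obtained by coning off at the first vertex, which never leaves the half space.
\<close>

section \<open>Chains, boundaries and cones\<close>

definition vcone :: "'a \<Rightarrow> 'a vr_chain \<Rightarrow> 'a vr_chain" where
  "vcone a = frag_extend (\<lambda>\<sigma>. frag_of (a # \<sigma>))"

lemma boundary_0 [simp]: "boundary q 0 = 0"
  by (simp add: boundary_def)

lemma boundary_diff: "boundary q (a - b) = boundary q a - boundary q b"
  by (simp add: boundary_def frag_extend_diff)

lemma boundary_add: "boundary q (a + b) = boundary q a + boundary q b"
  by (simp add: boundary_def frag_extend_add)

lemma vcone_0 [simp]: "vcone a 0 = 0"
  by (simp add: vcone_def)

lemma boundary_frag_of_Cons:
  "boundary (Suc q) (frag_of (a # \<sigma>)) = frag_of \<sigma> - vcone a (boundary q (frag_of \<sigma>))"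
proof -
  have "boundary (Suc q) (frag_of (a # \<sigma>)) =
      (\<Sum>i\<le>Suc q. frag_cmul ((-1) ^ i) (frag_of (face i (a # \<sigma>))))"
    by (simp add: boundary_def)
  also have "\<dots> = frag_of \<sigma> + (\<Sum>i\<le>q. frag_cmul ((-1) ^ Suc i) (frag_of (a # face i \<sigma>)))"
    by (simp add: sum.atMost_Suc_shift face_def del: sum.atMost_Suc)
  also have "(\<Sum>i\<le>q. frag_cmul ((-1) ^ Suc i) (frag_of (a # face i \<sigma>))) =
      - vcone a (boundary q (frag_of \<sigma>))"
    by (simp add: boundary_def vcone_def frag_extend_sum frag_extend_cmul o_def
        flip: sum_negf)
  finally show ?thesis by simp
qed

lemma boundary_vcone: "boundary (Suc q) (vcone a c) = c - vcone a (boundary q c)"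
  using subset_UNIV
proof (induction c rule: frag_induction)
  case (one \<sigma>)
  then show ?case
    using boundary_frag_of_Cons[of q a \<sigma>] by (simp add: vcone_def)
qed (simp_all add: vcone_def boundary_def frag_extend_diff)

lemma boundary_frag_of_Nil: "boundary q (frag_of []) = (if even q then frag_of [] else 0)"
  by (induction q) (auto simp: boundary_def face_def)

lemma boundary_0_frag_of: "boundary 0 (frag_of \<sigma>) = frag_of (tl \<sigma>)"
  by (cases \<sigma>) (simp_all add: boundary_def face_def)

lemma boundary_0_vcone: "boundary 0 (vcone a c) = c"
  using subset_UNIV
proof (induction c rule: frag_induction)
  case (one \<sigma>)
  then show ?case
    by (simp add: vcone_def boundary_0_frag_of)
qed (simp_all add: vcone_def boundary_def frag_extend_diff)

lemma boundary_boundary [simp]: "boundary q (boundary (Suc q) c) = 0"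
  using subset_UNIV
proof (induction c rule: frag_induction)
  case (one \<sigma>)
  show ?case
  proof (induction q arbitrary: \<sigma>)
    case 0
    show ?case
      by (cases \<sigma>) (simp_all add: boundary_frag_of_Nil boundary_frag_of_Cons boundary_diff
          boundary_0_vcone)
  next
    case (Suc q)
    show ?case
      by (cases \<sigma>) (simp_all add: boundary_frag_of_Nil boundary_frag_of_Cons boundary_diff
          boundary_vcone Suc)
  qed
qed (simp_all add: boundary_diff)

text \<open>Since the only face of a vertex is the empty list, \<open>boundary 0\<close> is the augmentation;
  degree \<open>0\<close> therefore needs no separate treatment.\<close>

lemma boundary_0_eq_augmentation:
  assumes "\<And>\<sigma>. \<sigma> \<in> Poly_Mapping.keys c \<Longrightarrow> length \<sigma> = 1"
  shows "boundary 0 c = frag_cmul (augmentation c) (frag_of [])"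
proof -
  have "boundary 0 c = frag_extend (\<lambda>\<sigma>. frag_of []) c"
    unfolding boundary_def
    by (rule frag_extend_eq) (use assms in \<open>auto simp: face_def\<close>)
  also have "\<dots> = frag_cmul (augmentation c) (frag_of [])"
    unfolding frag_extend_def augmentation_def
    by (rule poly_mapping_eqI) (simp add: lookup_sum)
  finally show ?thesis .
qed

lemma mem_simplices:
  "\<sigma> \<in> simplices X d q k \<longleftrightarrow>
    length \<sigma> = Suc q \<and> set \<sigma> \<subseteq> X \<and> (\<forall>x\<in>set \<sigma>. \<forall>y\<in>set \<sigma>. d x y \<le> k)"
  unfolding simplices_def mem_Collect_eq
  by (metis in_set_conv_nth less_Suc_eq_le)

lemma mem_vr_chains: "c \<in> vr_chains X d q k \<longleftrightarrow> Poly_Mapping.keys c \<subseteq> simplices X d q k"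
  by simp

lemma simplices_mono: "X \<subseteq> Y \<Longrightarrow> k \<le> l \<Longrightarrow> simplices X d q k \<subseteq> simplices Y d q l"
  unfolding subset_iff mem_simplices by (metis order_trans)

lemma vr_chains_mono: "X \<subseteq> Y \<Longrightarrow> k \<le> l \<Longrightarrow> vr_chains X d q k \<subseteq> vr_chains Y d q l"
  unfolding subset_iff mem_vr_chains using simplices_mono by (metis subset_iff)

lemma vr_chains_zero: "0 \<in> vr_chains X d q k"
  by simp

lemma vr_chains_diff:
  "a \<in> vr_chains X d q k \<Longrightarrow> b \<in> vr_chains X d q k \<Longrightarrow> a - b \<in> vr_chains X d q k"
  unfolding mem_vr_chains by (rule order_trans[OF keys_diff]) simp

lemma vr_chains_add:
  "a \<in> vr_chains X d q k \<Longrightarrow> b \<in> vr_chains X d q k \<Longrightarrow> a + b \<in> vr_chains X d q k"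
  unfolding mem_vr_chains by (rule order_trans[OF keys_add]) simp

lemma vr_chains_frag_extend:
  assumes "c \<in> vr_chains X d p i" "\<And>\<sigma>. \<sigma> \<in> simplices X d p i \<Longrightarrow> f \<sigma> \<in> vr_chains Y d' q k"
  shows "frag_extend f c \<in> vr_chains Y d' q k"
  using assms unfolding mem_vr_chains
  by (intro order_trans[OF keys_frag_extend] UN_least) blast

lemma vr_chains_induct [consumes 1, case_names zero one diff]:
  assumes "c \<in> vr_chains X d q k"
    and "P 0" "\<And>\<sigma>. \<sigma> \<in> simplices X d q k \<Longrightarrow> P (frag_of \<sigma>)"
    and "\<And>a b. a \<in> vr_chains X d q k \<Longrightarrow> b \<in> vr_chains X d q k \<Longrightarrow> P a \<Longrightarrow> P b \<Longrightarrow> P (a - b)"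
  shows "P c"
  using assms(1)[unfolded mem_vr_chains]
  by (rule free_Abelian_group_induct) (use assms(2-) in auto)

lemma face_in_simplices:
  assumes "\<sigma> \<in> simplices X d (Suc q) k" "i \<le> Suc q"
  shows "face i \<sigma> \<in> simplices X d q k"
proof -
  have "set (face i \<sigma>) \<subseteq> set \<sigma>"
    unfolding face_def by (auto dest: in_set_takeD in_set_dropD)
  moreover have "length (face i \<sigma>) = Suc q"
    using assms by (simp add: mem_simplices face_def)
  ultimately show ?thesis
    using assms(1) unfolding mem_simplices by blast
qed

lemma boundary_in_vr_chains:
  assumes "c \<in> vr_chains X d (Suc q) k"
  shows "boundary (Suc q) c \<in> vr_chains X d q k"
  unfolding boundary_def
  using assms
proof (rule vr_chains_frag_extend)
  fix \<sigma> assume \<sigma>: "\<sigma> \<in> simplices X d (Suc q) k"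
  show "(\<Sum>i\<le>Suc q. frag_cmul ((- 1) ^ i) (frag_of (face i \<sigma>))) \<in> vr_chains X d q k"
    by (intro sum_closed_free_Abelian_group)
      (use \<sigma> face_in_simplices in \<open>fastforce simp: keys_frag_of\<close>)
qed

lemma augmentation_eq_0_iff:
  "c \<in> vr_chains X d 0 k \<Longrightarrow> augmentation c = 0 \<longleftrightarrow> boundary 0 c = 0"
  by (subst boundary_0_eq_augmentation) (auto simp: mem_simplices subset_iff)

lemma augmentation_eq_iff:
  assumes "a \<in> vr_chains X d 0 k" "b \<in> vr_chains X d 0 k"
  shows "augmentation a = augmentation b \<longleftrightarrow> boundary 0 a = boundary 0 b"
proof -
  have "boundary 0 a = frag_cmul (augmentation a) (frag_of [])"
    "boundary 0 b = frag_cmul (augmentation b) (frag_of [])"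
    by (rule boundary_0_eq_augmentation; use assms in \<open>auto simp: mem_simplices subset_iff\<close>)+
  then show ?thesis
    by simp (metis lookup_frag_cmul lookup_frag_of mult.right_neutral)
qed

lemma mem_cycles: "c \<in> cycles X d q k \<longleftrightarrow> c \<in> vr_chains X d q k \<and> boundary q c = 0"
  unfolding cycles_def using augmentation_eq_0_iff[of c X d k] by (cases "q = 0") auto

lemma mem_boundaries:
  "c \<in> boundaries X d q k \<longleftrightarrow> (\<exists>e \<in> vr_chains X d (Suc q) k. boundary (Suc q) e = c)"
  unfolding boundaries_def by blast

lemma boundaries_zero: "0 \<in> boundaries X d q k"
  unfolding mem_boundaries using vr_chains_zero boundary_0 by blast

lemma boundaries_add:
  "a \<in> boundaries X d q k \<Longrightarrow> b \<in> boundaries X d q k \<Longrightarrow> a + b \<in> boundaries X d q k"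
  unfolding mem_boundaries using vr_chains_add boundary_add by metis

lemma boundaries_diff:
  "a \<in> boundaries X d q k \<Longrightarrow> b \<in> boundaries X d q k \<Longrightarrow> a - b \<in> boundaries X d q k"
  unfolding mem_boundaries using vr_chains_diff boundary_diff by metis

lemma boundaries_mono: "X \<subseteq> Y \<Longrightarrow> k \<le> l \<Longrightarrow> boundaries X d q k \<subseteq> boundaries Y d q l"
  unfolding boundaries_def using vr_chains_mono by (metis image_mono)

lemma homology_vanishes_iff:
  "homology_vanishes X d q i j \<longleftrightarrow> i \<le> j \<and> cycles X d q i \<subseteq> boundaries X d q j"
proof (cases "i \<le> j")
  case True
  have mono: "boundaries X d q i \<subseteq> boundaries X d q j"
    using True boundaries_mono by blast
  have carr: "carrier (reduced_homology X d q i) =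
      (\<lambda>z. {b + z | b. b \<in> boundaries X d q i}) ` cycles X d q i"
    by (auto simp: reduced_homology_def FactGroup_def RCOSETS_def r_coset_def)
  have incl: "inclusion_induced X d q j {b + z | b. b \<in> boundaries X d q i} =
      {b + (b' + z) | b b'. b \<in> boundaries X d q j \<and> b' \<in> boundaries X d q i}" for z
    by (auto simp: inclusion_induced_def set_mult_def)
  have unit: "\<one>\<^bsub>reduced_homology X d q j\<^esub> = boundaries X d q j"
    by (simp add: reduced_homology_def FactGroup_def)
  have "{b + (b' + z) | b b'. b \<in> boundaries X d q j \<and> b' \<in> boundaries X d q i} =
      boundaries X d q j \<longleftrightarrow> z \<in> boundaries X d q j" (is "?A = ?B \<longleftrightarrow> _") for z
  proof
    have "0 + (0 + z) \<in> ?A" using boundaries_zero by blast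
    then show "z \<in> ?B" if "?A = ?B" using that by simp
  next
    assume z: "z \<in> ?B"
    show "?A = ?B"
    proof
      show "?A \<subseteq> ?B" using mono z boundaries_add by blast
      show "?B \<subseteq> ?A"
      proof
        fix b assume "b \<in> ?B"
        then have "b - z \<in> ?B" using z boundaries_diff by blast
        moreover have "b = (b - z) + (0 + z)" by simp
        ultimately show "b \<in> ?A" using boundaries_zero by blast
      qed
    qed
  qed
  then show ?thesis
    using True unfolding homology_vanishes_def carr unit
    by (simp add: incl, simp add: subset_iff Ball_def)
qed (simp add: homology_vanishes_def)

lemma homology_vanishes_mono:
  "homology_vanishes X d q i j \<Longrightarrow> i' \<le> i \<Longrightarrow> j \<le> j' \<Longrightarrow> homology_vanishes X d q i' j'"
  unfolding homology_vanishes_iff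
  using boundaries_mono[of X X j j' d q] vr_chains_mono[of X X i' i d q]
  by (auto simp only: mem_cycles subset_iff)

lemma homology_vanishesD:
  assumes "homology_vanishes X d q i j" "z \<in> vr_chains X d q i" "boundary q z = 0"
  obtains c where "c \<in> vr_chains X d (Suc q) j" "boundary (Suc q) c = z"
  using assms unfolding homology_vanishes_iff by (meson mem_boundaries mem_cycles subsetD)

section \<open>The word metric\<close>

locale fg_group = group G for G :: "('a, 'b) monoid_scheme" (structure) +
  fixes S :: "'a set"
  assumes finite_S: "finite S" and S_subset: "S \<subseteq> carrier G"
    and generate_S: "generate G S = carrier G"
begin

abbreviation d :: "'a \<Rightarrow> 'a \<Rightarrow> real" where "d \<equiv> word_dist G S"

abbreviation letters :: "'a set" where "letters \<equiv> S \<union> (\<lambda>s. inv s) ` S"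

abbreviation word_value :: "'a list \<Rightarrow> 'a" where "word_value ws \<equiv> foldr (\<otimes>) ws \<one>"

lemma letters_subset: "letters \<subseteq> carrier G"
  using S_subset by auto

lemma foldr_mult:
  "set ws \<subseteq> carrier G \<Longrightarrow> x \<in> carrier G \<Longrightarrow> foldr (\<otimes>) ws x = word_value ws \<otimes> x"
  "set ws \<subseteq> carrier G \<Longrightarrow> word_value ws \<in> carrier G"
  by (induction ws) (auto simp: m_assoc)

lemma word_exists:
  assumes "g \<in> carrier G"
  shows "\<exists>ws. set ws \<subseteq> letters \<and> word_value ws = g"
  using assms unfolding generate_S[symmetric]
proof (induction rule: generate.induct)
  case one
  show ?case by (rule exI[of _ "[]"]) simp
next
  case (incl h)
  then show ?case using S_subset by (intro exI[of _ "[h]"]) auto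
next
  case (inv h)
  then show ?case using S_subset by (intro exI[of _ "[inv h]"]) auto
next
  case (eng h1 h2)
  then obtain v w where "set v \<subseteq> letters" "word_value v = h1" "set w \<subseteq> letters" "word_value w = h2"
    by blast
  then show ?case
    using letters_subset foldr_mult(1)[of v "word_value w"] foldr_mult(2)[of w]
    by (intro exI[of _ "v @ w"]) auto
qed

lemma word_length_attained:
  assumes "g \<in> carrier G"
  shows "\<exists>ws. length ws = word_length G S g \<and> set ws \<subseteq> letters \<and> word_value ws = g"
proof -
  have "\<exists>n ws. length ws = n \<and> set ws \<subseteq> letters \<and> word_value ws = g"
    using word_exists[OF assms] by blast
  from LeastI_ex[OF this] show ?thesis
    unfolding word_length_def .
qed

lemma word_length_le: "set ws \<subseteq> letters \<Longrightarrow> word_length G S (word_value ws) \<le> length ws"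
  unfolding word_length_def by (rule Least_le) blast

lemma finite_word_ball: "finite {g \<in> carrier G. word_length G S g \<le> n}"
proof (rule finite_subset)
  show "{g \<in> carrier G. word_length G S g \<le> n} \<subseteq>
      word_value ` {ws. set ws \<subseteq> letters \<and> length ws \<le> n}"
    using word_length_attained by force
  show "finite (word_value ` {ws. set ws \<subseteq> letters \<and> length ws \<le> n})"
    using finite_S by (intro finite_imageI finite_lists_length_le) simp
qed

lemma countable_carrier: "countable (carrier G)"
proof -
  have "carrier G = (\<Union>n. {g \<in> carrier G. word_length G S g \<le> n})"
    by auto
  then show ?thesis
    by (rule ssubst) (intro countable_UN countableI_type countable_finite finite_word_ball)
qed

lemma d_self: "x \<in> carrier G \<Longrightarrow> d x x = 0"
  using word_length_le[of "[]"] by (simp add: word_dist_def)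

lemma d_mult_left:
  assumes "g \<in> carrier G" "x \<in> carrier G" "y \<in> carrier G"
  shows "d (g \<otimes> x) (g \<otimes> y) = d x y"
proof -
  have "inv (g \<otimes> x) \<otimes> (g \<otimes> y) = inv x \<otimes> y"
    using assms by (simp add: inv_mult_group m_assoc) (simp flip: m_assoc)
  then show ?thesis by (simp add: word_dist_def)
qed

lemma d_mult_letter:
  assumes "s \<in> letters" "x \<in> carrier G"
  shows "d x (x \<otimes> s) \<le> 1" "d (x \<otimes> s) x \<le> 1"
proof -
  have s: "s \<in> carrier G" "inv s \<in> letters"
    using assms(1) S_subset by auto
  have *: "word_length G S u \<le> 1" if "u \<in> letters" "u \<in> carrier G" for u
    using word_length_le[of "[u]"] that by simp
  have "inv x \<otimes> (x \<otimes> s) = s" "inv (x \<otimes> s) \<otimes> x = inv s"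
    using assms(2) s(1) by (simp_all add: inv_mult_group inv_solve_right' m_assoc flip: m_assoc[of "inv x"])
  then show "d x (x \<otimes> s) \<le> 1" "d (x \<otimes> s) x \<le> 1"
    using *[OF assms(1) s(1)] *[OF s(2)] s(1) by (simp_all add: word_dist_def)
qed

lemma finite_base_simplices: "finite (base_simplices G S q k)"
proof (rule finite_subset)
  let ?B = "{g \<in> carrier G. word_length G S g \<le> nat \<lfloor>k\<rfloor>}"
  show "base_simplices G S q k \<subseteq> {\<sigma>. set \<sigma> \<subseteq> ?B \<and> length \<sigma> = Suc q}"
  proof
    fix \<sigma> assume \<sigma>: "\<sigma> \<in> base_simplices G S q k"
    then have "\<one> \<in> set \<sigma>"
      unfolding base_simplices_def mem_simplices mem_Collect_eq
      by (metis hd_in_set length_0_conv nat.simps(3))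
    then have "d \<one> y \<le> k" "y \<in> carrier G" if "y \<in> set \<sigma>" for y
      using \<sigma> that by (auto simp: base_simplices_def mem_simplices)
    then have "set \<sigma> \<subseteq> ?B"
      by (auto simp: word_dist_def le_nat_floor)
    then show "\<sigma> \<in> {\<sigma>. set \<sigma> \<subseteq> ?B \<and> length \<sigma> = Suc q}"
      using \<sigma> by (simp add: base_simplices_def mem_simplices)
  qed
  show "finite {\<sigma>. set \<sigma> \<subseteq> ?B \<and> length \<sigma> = Suc q}"
    using finite_word_ball by (rule finite_lists_length_eq)
qed

section \<open>Equivariance\<close>

lemma translate_0 [simp]: "translate G g 0 = 0"
  by (simp add: translate_def)

lemma translate_diff: "translate G g (a - b) = translate G g a - translate G g b"
  by (simp add: translate_def frag_extend_diff)

lemma translate_frag_of: "translate G g (frag_of \<sigma>) = frag_of (map (\<lambda>x. g \<otimes> x) \<sigma>)"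
  by (simp add: translate_def)

lemma map_mult_in_simplices:
  assumes "\<sigma> \<in> simplices (carrier G) d q k" "g \<in> carrier G"
  shows "map (\<lambda>x. g \<otimes> x) \<sigma> \<in> simplices (carrier G) d q k"
  using assms d_mult_left by (auto simp: mem_simplices subset_iff)

lemma translate_one: "c \<in> vr_chains (carrier G) d q k \<Longrightarrow> translate G \<one> c = c"
proof (induction rule: vr_chains_induct)
  case (one \<sigma>)
  then have "map (\<lambda>x. \<one> \<otimes> x) \<sigma> = \<sigma>"
    by (intro map_idI) (auto simp: mem_simplices)
  then show ?case by (simp add: translate_frag_of)
qed (simp_all add: translate_diff)

lemma translate_translate:
  assumes "c \<in> vr_chains (carrier G) d q k" "g \<in> carrier G" "h \<in> carrier G"
  shows "translate G g (translate G h c) = translate G (g \<otimes> h) c"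
  using assms(1)
proof (induction rule: vr_chains_induct)
  case (one \<sigma>)
  then show ?case using assms(2,3)
    by (auto simp: translate_frag_of mem_simplices m_assoc subset_iff intro!: arg_cong[of _ _ frag_of])
qed (simp_all add: translate_diff)

lemma boundary_translate: "boundary q (translate G g c) = translate G g (boundary q c)"
  using subset_UNIV
proof (induction c rule: frag_induction)
  case (one \<sigma>)
  show ?case
    by (simp add: translate_def boundary_def frag_extend_sum frag_extend_cmul o_def face_def
        take_map drop_map)
qed (simp_all add: translate_diff boundary_diff)

lemma base_simplexD:
  assumes "x \<in> base_simplices G S q k"
  shows "x \<in> simplices (carrier G) d q k" "hd x = \<one>" "\<one> \<in> set x" "set x \<subseteq> carrier G"
  using assms unfolding base_simplices_def mem_simplices
  by (auto simp: dest: hd_in_set) (metis hd_in_set list.size(3) nat.simps(3))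

lemma simplex_translate_base:
  assumes "\<sigma> \<in> simplices (carrier G) d q k"
  shows "hd \<sigma> \<in> carrier G"
    and "map (\<lambda>x. inv (hd \<sigma>) \<otimes> x) \<sigma> \<in> base_simplices G S q k"
    and "map (\<lambda>x. hd \<sigma> \<otimes> x) (map (\<lambda>x. inv (hd \<sigma>) \<otimes> x) \<sigma>) = \<sigma>"
proof -
  have ne: "\<sigma> \<noteq> []" and sub: "set \<sigma> \<subseteq> carrier G"
    using assms by (auto simp: mem_simplices)
  then show hd: "hd \<sigma> \<in> carrier G"
    by (auto dest: hd_in_set)
  then show "map (\<lambda>x. inv (hd \<sigma>) \<otimes> x) \<sigma> \<in> base_simplices G S q k"
    using assms ne map_mult_in_simplices by (simp add: base_simplices_def hd_map)
  show "map (\<lambda>x. hd \<sigma> \<otimes> x) (map (\<lambda>x. inv (hd \<sigma>) \<otimes> x) \<sigma>) = \<sigma>"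
    unfolding map_map
    by (rule map_idI) (use hd sub in \<open>auto simp: subset_iff simp flip: m_assoc\<close>)
qed

lemma linear_extension_translate_base:
  assumes "x \<in> base_simplices G S q k" "g \<in> carrier G"
  shows "linear_extension G f (frag_of (map (\<lambda>x. g \<otimes> x) x)) = translate G g (f x)"
proof -
  have "hd (map (\<lambda>x. g \<otimes> x) x) = g"
    using assms base_simplexD[OF assms(1)] by (subst hd_map) auto
  moreover have "map (\<lambda>y. inv g \<otimes> y) (map (\<lambda>x. g \<otimes> x) x) = x"
    unfolding map_map
    by (rule map_idI) (use assms base_simplexD[OF assms(1)] in \<open>auto simp: subset_iff simp flip: m_assoc\<close>)
  ultimately show ?thesis
    by (simp add: linear_extension_def del: map_map)
qed

lemma linear_extension_diff:
  "linear_extension G f (a - b) = linear_extension G f a - linear_extension G f b"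
  by (simp add: linear_extension_def frag_extend_diff)

end

locale character_group = fg_group +
  fixes \<chi> :: "'a \<Rightarrow> real"
  assumes character: "\<chi> \<in> hom G real_add_group"
begin

abbreviation chains :: "nat \<Rightarrow> real \<Rightarrow> 'a vr_chain set" where
  "chains q k \<equiv> vr_chains (carrier G) d q k"

abbreviation chains_above :: "real \<Rightarrow> nat \<Rightarrow> real \<Rightarrow> 'a vr_chain set" where
  "chains_above L q k \<equiv> vr_chains (superlevel G \<chi> L) d q k"

lemma character_mult: "g \<in> carrier G \<Longrightarrow> h \<in> carrier G \<Longrightarrow> \<chi> (g \<otimes> h) = \<chi> g + \<chi> h"
  using character by (simp add: hom_def real_add_group_def)

lemma character_one: "\<chi> \<one> = 0"
  using character_mult[of \<one> \<one>] by simp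

lemma character_inv: "g \<in> carrier G \<Longrightarrow> \<chi> (inv g) = - \<chi> g"
  using character_mult[of g "inv g"] character_one by simp

lemma character_pow: "g \<in> carrier G \<Longrightarrow> \<chi> (g [^] (n::nat)) = real n * \<chi> g"
  by (induction n) (simp_all add: character_one character_mult algebra_simps)

lemma superlevel_subset: "superlevel G \<chi> L \<subseteq> carrier G"
  by (auto simp: superlevel_def)

lemma superlevel_antimono: "L \<le> L' \<Longrightarrow> superlevel G \<chi> L' \<subseteq> superlevel G \<chi> L"
  by (auto simp: superlevel_def)

lemma mem_simplices_superlevel:
  "\<sigma> \<in> simplices (superlevel G \<chi> L) d q k \<longleftrightarrow>
    \<sigma> \<in> simplices (carrier G) d q k \<and> L \<le> simplex_val \<chi> \<sigma>"
proof -
  have "set \<sigma> \<subseteq> superlevel G \<chi> L \<longleftrightarrow> set \<sigma> \<subseteq> carrier G \<and> L \<le> simplex_val \<chi> \<sigma>"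
    if "length \<sigma> = Suc q"
  proof -
    from that have "set \<sigma> \<noteq> {}" by auto
    then show ?thesis by (auto simp: superlevel_def simplex_val_def)
  qed
  then show ?thesis unfolding mem_simplices by blast
qed

lemma chains_above_subset: "c \<in> chains_above L q k \<Longrightarrow> c \<in> chains q k"
  using vr_chains_mono[OF superlevel_subset order_refl] by blast

lemma chains_above_antimono:
  "c \<in> chains_above L q k \<Longrightarrow> L' \<le> L \<Longrightarrow> k \<le> k' \<Longrightarrow> c \<in> chains_above L' q k'"
  using vr_chains_mono[OF superlevel_antimono] by blast

lemma frag_of_in_chains_above:
  "\<sigma> \<in> simplices (carrier G) d q k \<Longrightarrow> frag_of \<sigma> \<in> chains_above (simplex_val \<chi> \<sigma>) q k"
  by (simp add: keys_frag_of mem_simplices_superlevel)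

lemma chains_bounded_below:
  assumes "c \<in> chains q k"
  shows "\<exists>L. c \<in> chains_above L q k"
  using assms
proof (induction rule: vr_chains_induct)
  case (one \<sigma>)
  then show ?case using frag_of_in_chains_above by blast
next
  case (diff a b)
  then obtain L L' where "a \<in> chains_above L q k" "b \<in> chains_above L' q k" by blast
  then have "a - b \<in> chains_above (min L L') q k"
    by (intro vr_chains_diff) (auto intro: chains_above_antimono simp del: carrier_free_Abelian_group_iff)
  then show ?case ..
qed simp

lemma simplex_val_translate:
  assumes "\<sigma> \<in> simplices (carrier G) d q k" "g \<in> carrier G"
  shows "simplex_val \<chi> (map (\<lambda>x. g \<otimes> x) \<sigma>) = \<chi> g + simplex_val \<chi> \<sigma>"
proof -
  have "set \<sigma> \<noteq> {}" "set \<sigma> \<subseteq> carrier G"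
    using assms by (auto simp: mem_simplices)
  then have "\<chi> ` set (map (\<lambda>x. g \<otimes> x) \<sigma>) = (\<lambda>r. \<chi> g + r) ` (\<chi> ` set \<sigma>)"
    using assms(2) by (force simp: character_mult subset_iff image_image)
  then show ?thesis
    using \<open>set \<sigma> \<noteq> {}\<close> unfolding simplex_val_def
    by (simp add: mono_Min_commute[of "\<lambda>r. \<chi> g + r" "\<chi> ` set \<sigma>"] monoI)
qed

lemma translate_in_chains_above:
  assumes "c \<in> chains_above L q k" "g \<in> carrier G"
  shows "translate G g c \<in> chains_above (L + \<chi> g) q k"
  unfolding translate_def
  by (rule vr_chains_frag_extend[OF assms(1)])
    (use assms(2) in \<open>auto simp: keys_frag_of mem_simplices_superlevel simplex_val_translate
      map_mult_in_simplices\<close>)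

definition emap ::
    "real \<Rightarrow> nat \<Rightarrow> real \<Rightarrow> nat \<Rightarrow> real \<Rightarrow> ('a vr_chain \<Rightarrow> 'a vr_chain) \<Rightarrow> bool" where
  "emap R p i q b f \<longleftrightarrow>
     (\<forall>a c. f (a - c) = f a - f c) \<and>
     (\<forall>g\<in>carrier G. \<forall>c\<in>chains p i. f (translate G g c) = translate G g (f c)) \<and>
     (\<forall>L. \<forall>c\<in>chains_above L p i. f c \<in> chains_above (L + R) q b)"

lemma emap_diff: "emap R p i q b f \<Longrightarrow> f (a - c) = f a - f c"
  by (simp add: emap_def)

lemma emap_zero: "emap R p i q b f \<Longrightarrow> f 0 = 0"
  using emap_diff[of R p i q b f 0 0] by simp

lemma emap_translate:
  "emap R p i q b f \<Longrightarrow> g \<in> carrier G \<Longrightarrow> c \<in> chains p i \<Longrightarrow>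
    f (translate G g c) = translate G g (f c)"
  unfolding emap_def by blast

lemma emap_above:
  "emap R p i q b f \<Longrightarrow> c \<in> chains_above L p i \<Longrightarrow> f c \<in> chains_above (L + R) q b"
  unfolding emap_def by blast

lemma emap_closed: "emap R p i q b f \<Longrightarrow> c \<in> chains p i \<Longrightarrow> f c \<in> chains q b"
  using chains_bounded_below emap_above chains_above_subset by blast

lemma emapI:
  assumes diff: "\<And>a c. f (a - c) = f a - f c"
    and base: "\<And>x. x \<in> base_simplices G S p i \<Longrightarrow>
      f (frag_of x) \<in> chains_above (simplex_val \<chi> x + R) q b"
    and eqv: "\<And>x g. x \<in> base_simplices G S p i \<Longrightarrow> g \<in> carrier G \<Longrightarrow>
      f (frag_of (map (\<lambda>y. g \<otimes> y) x)) = translate G g (f (frag_of x))"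
  shows "emap R p i q b f"
  unfolding emap_def
proof (intro conjI allI ballI)
  show "f (a - c) = f a - f c" for a c by (rule diff)
  have f0: "f 0 = 0" using diff[of 0 0] by simp
  show "f (translate G g c) = translate G g (f c)" if g: "g \<in> carrier G" and "c \<in> chains p i" for g c
    using that(2)
  proof (induction rule: vr_chains_induct)
    case (one \<sigma>)
    let ?h = "hd \<sigma>" and ?x = "map (\<lambda>x. inv (hd \<sigma>) \<otimes> x) \<sigma>"
    note \<sigma> = simplex_translate_base[OF one]
    have "map (\<lambda>y. g \<otimes> y) \<sigma> = map (\<lambda>y. g \<otimes> y) (map (\<lambda>y. ?h \<otimes> y) ?x)"
      by (simp only: \<sigma>(3))
    also have "\<dots> = map (\<lambda>y. (g \<otimes> ?h) \<otimes> y) ?x"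
      unfolding map_map[of _ "\<lambda>y. ?h \<otimes> y"]
      by (rule map_cong[OF refl]) (use g \<sigma>(1) base_simplexD(4)[OF \<sigma>(2)] in \<open>auto simp: m_assoc subset_iff simp del: set_map\<close>)
    finally have "f (translate G g (frag_of \<sigma>)) = translate G (g \<otimes> ?h) (f (frag_of ?x))"
      unfolding translate_frag_of by (simp only: eqv[OF \<sigma>(2) m_closed[OF g \<sigma>(1)]])
    also have "\<dots> = translate G g (translate G ?h (f (frag_of ?x)))"
      by (rule translate_translate[symmetric, OF chains_above_subset[OF base[OF \<sigma>(2)]] g \<sigma>(1)])
    also have "translate G ?h (f (frag_of ?x)) = f (frag_of \<sigma>)"
      using eqv[OF \<sigma>(2) \<sigma>(1)] unfolding \<sigma>(3) by simp
    finally show ?case .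
  qed (simp_all add: f0 diff translate_diff)
  show "f c \<in> chains_above (L + R) q b" if "c \<in> chains_above L p i" for L c
    using that
  proof (induction rule: vr_chains_induct)
    case (one \<sigma>)
    then have \<sigma>1: "\<sigma> \<in> simplices (carrier G) d p i" and L: "L \<le> simplex_val \<chi> \<sigma>"
      by (auto simp: mem_simplices_superlevel)
    let ?h = "hd \<sigma>" and ?x = "map (\<lambda>x. inv (hd \<sigma>) \<otimes> x) \<sigma>"
    note \<sigma> = simplex_translate_base[OF \<sigma>1]
    have "simplex_val \<chi> \<sigma> = \<chi> ?h + simplex_val \<chi> ?x"
      using simplex_val_translate[OF base_simplexD(1)[OF \<sigma>(2)] \<sigma>(1)] unfolding \<sigma>(3) .
    moreover have "translate G ?h (f (frag_of ?x)) \<in> chains_above (simplex_val \<chi> ?x + R + \<chi> ?h) q b"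
      by (rule translate_in_chains_above[OF base[OF \<sigma>(2)] \<sigma>(1)])
    moreover have "translate G ?h (f (frag_of ?x)) = f (frag_of \<sigma>)"
      using eqv[OF \<sigma>(2) \<sigma>(1)] unfolding \<sigma>(3) by simp
    ultimately show ?case
      using L by (auto intro: chains_above_antimono simp del: carrier_free_Abelian_group_iff)
  next
    case (diff a c)
    then show ?case by (simp only: assms(1) vr_chains_diff)
  qed (simp add: f0)
qed

lemma emap_frag_of_translate:
  assumes "emap R p i q b f" "x \<in> base_simplices G S p i" "g \<in> carrier G"
  shows "f (frag_of (map (\<lambda>y. g \<otimes> y) x)) = translate G g (f (frag_of x))"
  using emap_translate[OF assms(1) assms(3), of "frag_of x"] base_simplexD(1)[OF assms(2)]
  by (simp add: translate_frag_of keys_frag_of)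

lemma emap_base:
  assumes "emap R p i q b f" "x \<in> base_simplices G S p i"
  shows "f (frag_of x) \<in> chains_above (simplex_val \<chi> x + R) q b"
  using emap_above[OF assms(1)] frag_of_in_chains_above base_simplexD(1)[OF assms(2)] by blast

lemma emap_eqI:
  fixes f f' :: "'a vr_chain \<Rightarrow> 'a vr_chain"
  assumes "\<And>a c. f (a - c) = f a - f c" "\<And>a c. f' (a - c) = f' a - f' c"
    and "\<And>x g. x \<in> base_simplices G S p i \<Longrightarrow> g \<in> carrier G \<Longrightarrow>
      f (frag_of (map (\<lambda>y. g \<otimes> y) x)) = f' (frag_of (map (\<lambda>y. g \<otimes> y) x))"
    and "c \<in> chains p i"
  shows "f c = f' c"
  using assms(4)
proof (induction rule: vr_chains_induct)
  case zero
  show ?case using assms(1)[of 0 0] assms(2)[of 0 0] by simp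
next
  case (one \<sigma>)
  from simplex_translate_base[OF one] show ?case using assms(3) by metis
qed (simp_all add: assms(1,2))

lemma emap_mono: "emap R p i q b f \<Longrightarrow> R' \<le> R \<Longrightarrow> b \<le> b' \<Longrightarrow> emap R' p i q b' f"
  unfolding emap_def using chains_above_antimono add_left_mono by meson

lemma emap_source_mono: "emap R p i q b f \<Longrightarrow> i' \<le> i \<Longrightarrow> emap R p i' q b f"
  unfolding emap_def using vr_chains_mono[OF subset_refl, of i' i] by (meson subsetD)

lemma emap_comp:
  assumes "emap R p i q b f" "emap R' q b r b' f'"
  shows "emap (R + R') p i r b' (\<lambda>c. f' (f c))"
  unfolding emap_def
proof (intro conjI allI ballI)
  show "f' (f (translate G g c)) = translate G g (f' (f c))"
    if "g \<in> carrier G" "c \<in> chains p i" for g c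
    using emap_translate[OF assms(1) that] emap_translate[OF assms(2) that(1) emap_closed[OF assms(1) that(2)]]
    by simp
  show "f' (f c) \<in> chains_above (L + (R + R')) r b'" if "c \<in> chains_above L p i" for c L
    using emap_above[OF assms(2) emap_above[OF assms(1) that]] by (simp add: add.assoc)
qed (simp add: emap_diff[OF assms(1)] emap_diff[OF assms(2)])

lemma emap_minus:
  assumes "emap R p i q b f" "emap R p i q b f'"
  shows "emap R p i q b (\<lambda>c. f c - f' c)"
  unfolding emap_def
proof (intro conjI allI ballI)
  show "f c - f' c \<in> chains_above (L + R) q b" if "c \<in> chains_above L p i" for c L
    by (intro vr_chains_diff emap_above[OF assms(1)] emap_above[OF assms(2)] that)
qed (simp_all add: emap_diff[OF assms(1)] emap_diff[OF assms(2)] emap_translate[OF assms(1)]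
    emap_translate[OF assms(2)] translate_diff del: carrier_free_Abelian_group_iff)

lemma emap_ident: "emap 0 p i p i (\<lambda>c. c)"
  by (simp add: emap_def)

lemma emap_boundary: "emap 0 (Suc p) i p i (boundary (Suc p))"
  unfolding emap_def
  by (intro conjI allI ballI)
    (simp_all only: boundary_diff boundary_translate boundary_in_vr_chains add_0_right)

lemma emap_linear_extension:
  assumes "\<And>x. x \<in> base_simplices G S p i \<Longrightarrow> f x \<in> chains_above (simplex_val \<chi> x + R) q b"
  shows "emap R p i q b (linear_extension G f)"
    and "\<And>x. x \<in> base_simplices G S p i \<Longrightarrow> linear_extension G f (frag_of x) = f x"
proof -
  show *: "linear_extension G f (frag_of x) = f x" if "x \<in> base_simplices G S p i" for x
  proof -
    have "linear_extension G f (frag_of (map (\<lambda>y. \<one> \<otimes> y) x)) = translate G \<one> (f x)"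
      by (rule linear_extension_translate_base[OF that one_closed])
    moreover have "map (\<lambda>y. \<one> \<otimes> y) x = x"
      by (rule map_idI) (use base_simplexD[OF that] in auto)
    ultimately show ?thesis
      using translate_one[OF chains_above_subset[OF assms[OF that]]] by simp
  qed
  show "emap R p i q b (linear_extension G f)"
    by (rule emapI) (simp_all only: linear_extension_diff * assms linear_extension_translate_base)
qed

lemma emap_linear_extension_cong:
  assumes "\<And>x. x \<in> base_simplices G S p i \<Longrightarrow> f x = f' (frag_of x)" "emap R p i q b f'"
    and "c \<in> chains p i"
  shows "linear_extension G f c = f' c"
  by (rule emap_eqI[OF linear_extension_diff emap_diff[OF assms(2)] _ assms(3)])
    (simp only: linear_extension_translate_base emap_frag_of_translate[OF assms(2)] assms(1))

section \<open>Filling\<close>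

lemma emap_fill:
  assumes F: "emap R' p i q' b' F"
    and base: "\<And>x. x \<in> base_simplices G S p i \<Longrightarrow>
      \<exists>y \<in> chains_above (simplex_val \<chi> x + R) q b. boundary q y = F (frag_of x)"
  shows "\<exists>E. emap R p i q b E \<and> (\<forall>c\<in>chains p i. boundary q (E c) = F c)"
proof -
  obtain f where f: "f x \<in> chains_above (simplex_val \<chi> x + R) q b" "boundary q (f x) = F (frag_of x)"
    if "x \<in> base_simplices G S p i" for x
    using base by metis
  have E: "emap R p i q b (linear_extension G f)"
    using f(1) by (rule emap_linear_extension)
  have "boundary q (linear_extension G f c) = F c" if "c \<in> chains p i" for c
    by (rule emap_eqI[OF _ emap_diff[OF F] _ that])
      (simp_all only: linear_extension_diff boundary_diff linear_extension_translate_base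
        boundary_translate emap_frag_of_translate[OF F] f(2))
  with E show ?thesis by blast
qed

lemma emap_fill_homology:
  assumes F: "emap R' p i q a F" and cyc: "\<forall>c\<in>chains p i. boundary q (F c) = 0"
    and van: "homology_vanishes (carrier G) d q a b"
  shows "\<exists>R E. emap R p i (Suc q) b E \<and> (\<forall>c\<in>chains p i. boundary (Suc q) (E c) = F c)"
proof -
  define P where "P x r \<longleftrightarrow>
      (\<exists>y \<in> chains_above (simplex_val \<chi> x + r) (Suc q) b. boundary (Suc q) y = F (frag_of x))" for x r
  have "\<forall>x \<in> base_simplices G S p i. eventually (P x) at_bot"
  proof
    fix x assume "x \<in> base_simplices G S p i"
    then have x: "frag_of x \<in> chains p i"
      using base_simplexD(1) by (simp add: keys_frag_of)
    from van emap_closed[OF F x] bspec[OF cyc x] obtain y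
      where y: "y \<in> chains (Suc q) b" "boundary (Suc q) y = F (frag_of x)"
      by (rule homology_vanishesD)
    from chains_bounded_below[OF y(1)] obtain L where L: "y \<in> chains_above L (Suc q) b" ..
    have "P x r" if "r \<le> L - simplex_val \<chi> x" for r
      unfolding P_def using y(2) chains_above_antimono[OF L, of _ b] that
      by (intro bexI[where x = y]) (simp_all del: carrier_free_Abelian_group_iff)
    then show "eventually (P x) at_bot"
      unfolding eventually_at_bot_linorder by blast
  qed
  then have "eventually (\<lambda>r. \<forall>x \<in> base_simplices G S p i. P x r) at_bot"
    using finite_base_simplices by (rule eventually_ball_finite[rotated])
  then obtain r where "\<forall>x \<in> base_simplices G S p i. P x r"
    unfolding eventually_at_bot_linorder by blast
  then have "\<exists>y \<in> chains_above (simplex_val \<chi> x + r) (Suc q) b. boundary (Suc q) y = F (frag_of x)"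
    if "x \<in> base_simplices G S p i" for x
    using that unfolding P_def by blast
  from emap_fill[OF F this] show ?thesis by blast
qed

text \<open>Coning a cycle off at the first vertex of the simplex keeps the valuation: the price is
  an uncontrolled but uniform scale.\<close>

lemma emap_fill_cone:
  assumes F: "emap 0 p i q a F" and cyc: "\<forall>c\<in>chains p i. boundary q (F c) = 0"
  shows "\<exists>b E. emap 0 p i (Suc q) b E \<and> (\<forall>c\<in>chains p i. boundary (Suc q) (E c) = F c)"
proof -
  define P where "P x b \<longleftrightarrow>
      (\<exists>y \<in> chains_above (simplex_val \<chi> x + 0) (Suc q) b. boundary (Suc q) y = F (frag_of x))" for x b
  have "\<forall>x \<in> base_simplices G S p i. eventually (P x) at_top"
  proof
    fix x assume x: "x \<in> base_simplices G S p i"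
    then have xc: "frag_of x \<in> chains p i"
      using base_simplexD(1) by (simp add: keys_frag_of)
    let ?y = "vcone \<one> (F (frag_of x))"
    define V where "V = insert \<one> (\<Union>(set ` Poly_Mapping.keys (F (frag_of x))))"
    have Fx: "Poly_Mapping.keys (F (frag_of x)) \<subseteq> simplices (superlevel G \<chi> (simplex_val \<chi> x)) d q a"
      using emap_base[OF F x] by simp
    have one: "\<one> \<in> superlevel G \<chi> (simplex_val \<chi> x)"
      using base_simplexD(3)[OF x] by (simp add: superlevel_def simplex_val_def)
    have "finite (V \<times> V)"
      unfolding V_def by simp
    then have "eventually (\<lambda>b. \<forall>(u, v) \<in> V \<times> V. d u v \<le> b) at_top"
      by (rule eventually_ball_finite) (simp add: eventually_ge_at_top split: prod.split)
    then show "eventually (P x) at_top"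
    proof eventually_elim
      case (elim b)
      have "Poly_Mapping.keys ?y \<subseteq> (\<lambda>\<tau>. \<one> # \<tau>) ` Poly_Mapping.keys (F (frag_of x))"
        unfolding vcone_def by (rule order_trans[OF keys_frag_extend]) (auto simp: keys_frag_of)
      also have "\<dots> \<subseteq> simplices (superlevel G \<chi> (simplex_val \<chi> x)) d (Suc q) b"
      proof (rule image_subsetI)
        fix \<tau> assume \<tau>: "\<tau> \<in> Poly_Mapping.keys (F (frag_of x))"
        then have "set (\<one> # \<tau>) \<subseteq> V" by (auto simp: V_def)
        then have "d u v \<le> b" if "u \<in> set (\<one> # \<tau>)" "v \<in> set (\<one> # \<tau>)" for u v
          using elim that by blast
        then show "\<one> # \<tau> \<in> simplices (superlevel G \<chi> (simplex_val \<chi> x)) d (Suc q) b"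
          using subsetD[OF Fx \<tau>] one by (simp add: mem_simplices)
      qed
      finally have "?y \<in> chains_above (simplex_val \<chi> x + 0) (Suc q) b" by simp
      moreover have "boundary (Suc q) ?y = F (frag_of x)"
        by (simp add: boundary_vcone bspec[OF cyc xc])
      ultimately show ?case unfolding P_def by blast
    qed
  qed
  then have "eventually (\<lambda>b. \<forall>x \<in> base_simplices G S p i. P x b) at_top"
    using finite_base_simplices by (rule eventually_ball_finite[rotated])
  then obtain b where "\<forall>x \<in> base_simplices G S p i. P x b"
    unfolding eventually_at_top_linorder by blast
  then have "\<exists>y \<in> chains_above (simplex_val \<chi> x + 0) (Suc q) b. boundary (Suc q) y = F (frag_of x)"
    if "x \<in> base_simplices G S p i" for x
    using that unfolding P_def by blast
  from emap_fill[OF F this] show ?thesis by blast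
qed

section \<open>Chain maps and homotopies\<close>

definition cmap ::
    "real \<Rightarrow> real \<Rightarrow> (nat \<Rightarrow> real) \<Rightarrow> nat \<Rightarrow> (nat \<Rightarrow> 'a vr_chain \<Rightarrow> 'a vr_chain) \<Rightarrow> bool" where
  "cmap R i s m f \<longleftrightarrow>
     (\<forall>p\<le>m. emap R p i p (s p) (f p)) \<and>
     (\<forall>p<m. \<forall>c\<in>chains (Suc p) i. boundary (Suc p) (f (Suc p) c) = f p (boundary (Suc p) c)) \<and>
     (\<forall>c\<in>chains 0 i. boundary 0 (f 0 c) = boundary 0 c)"

lemma cmap_emap: "cmap R i s m f \<Longrightarrow> p \<le> m \<Longrightarrow> emap R p i p (s p) (f p)"
  by (simp add: cmap_def)

lemma cmap_boundary:
  "cmap R i s m f \<Longrightarrow> Suc p \<le> m \<Longrightarrow> c \<in> chains (Suc p) i \<Longrightarrow>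
    boundary (Suc p) (f (Suc p) c) = f p (boundary (Suc p) c)"
  unfolding cmap_def by (meson Suc_le_eq)

lemma cmap_boundary_0: "cmap R i s m f \<Longrightarrow> c \<in> chains 0 i \<Longrightarrow> boundary 0 (f 0 c) = boundary 0 c"
  unfolding cmap_def by blast

lemma cmap_cycle:
  assumes "cmap R i s m f" "p \<le> m" "z \<in> chains p i" "boundary p z = 0"
  shows "boundary p (f p z) = 0"
proof (cases p)
  case 0
  then show ?thesis using cmap_boundary_0 assms by metis
next
  case (Suc p')
  then show ?thesis
    using cmap_boundary[OF assms(1), of p' z] assms emap_zero[OF cmap_emap[OF assms(1), of p']]
    by (simp del: carrier_free_Abelian_group_iff)
qed

lemma cmap_source_mono: "cmap R i s m f \<Longrightarrow> i' \<le> i \<Longrightarrow> cmap R i' s m f"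
  using vr_chains_mono[OF subset_refl, of i' i "carrier G" d] emap_source_mono[of R _ i _ _ _ i']
  unfolding cmap_def subset_iff by (simp del: carrier_free_Abelian_group_iff)

lemma cmap_mono: "cmap R i s m f \<Longrightarrow> R' \<le> R \<Longrightarrow> (\<And>p. p \<le> m \<Longrightarrow> s p \<le> s' p) \<Longrightarrow> cmap R' i s' m f"
  unfolding cmap_def by (auto intro: emap_mono simp del: carrier_free_Abelian_group_iff)

lemma cmap_comp:
  assumes f: "cmap R i (\<lambda>_. k) m f" and g: "cmap R' k s m g"
  shows "cmap (R + R') i s m (\<lambda>p c. g p (f p c))"
  unfolding cmap_def
proof (intro conjI allI impI ballI)
  show "emap (R + R') p i p (s p) (\<lambda>c. g p (f p c))" if "p \<le> m" for p
    using cmap_emap[OF f that] cmap_emap[OF g that] by (rule emap_comp)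
  show "boundary (Suc p) (g (Suc p) (f (Suc p) c)) = g p (f p (boundary (Suc p) c))"
    if "p < m" "c \<in> chains (Suc p) i" for p c
    using cmap_boundary[OF f Suc_leI[OF that(1)] that(2)]
      cmap_boundary[OF g Suc_leI[OF that(1)] emap_closed[OF cmap_emap[OF f Suc_leI[OF that(1)]] that(2)]]
    by simp
  show "boundary 0 (g 0 (f 0 c)) = boundary 0 c" if "c \<in> chains 0 i" for c
    using cmap_boundary_0[OF f that] cmap_boundary_0[OF g emap_closed[OF cmap_emap[OF f le0] that]]
    by simp
qed

lemma cmap_extend:
  assumes f: "cmap R i s m f" and E: "emap R (Suc m) i (Suc m) (s (Suc m)) E"
    and bd: "\<forall>c\<in>chains (Suc m) i. boundary (Suc m) (E c) = f m (boundary (Suc m) c)"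
  shows "cmap R i s (Suc m) (f(Suc m := E))"
  using assms unfolding cmap_def by (auto simp: le_Suc_eq less_Suc_eq simp del: carrier_free_Abelian_group_iff)

lemma emap_cmap_boundary:
  assumes f: "cmap R i s m f"
  shows "emap R (Suc m) i m (s m) (\<lambda>c. f m (boundary (Suc m) c))"
    and "\<forall>c\<in>chains (Suc m) i. boundary m (f m (boundary (Suc m) c)) = 0"
  using emap_comp[OF emap_boundary cmap_emap[OF f order_refl]]
    cmap_cycle[OF f order_refl boundary_in_vr_chains boundary_boundary]
  by (simp_all del: carrier_free_Abelian_group_iff)

lemma cmap_retract:
  assumes "\<And>q. q < m \<Longrightarrow> homology_vanishes (carrier G) d q (n q) (n (Suc q))" and "0 \<le> n 0"
  shows "\<exists>R f. cmap R i n m f"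
  using assms(1)
proof (induction m)
  case 0
  have "c \<in> chains_above L 0 (n 0)" if "c \<in> chains_above L 0 i" for c L
  proof -
    have "simplices (superlevel G \<chi> L) d 0 i \<subseteq> simplices (superlevel G \<chi> L) d 0 (n 0)"
      using assms(2) superlevel_subset d_self by (auto simp: mem_simplices length_Suc_conv subset_iff)
    with that show ?thesis by auto
  qed
  then have "cmap 0 i n 0 (\<lambda>p c. c)"
    by (simp add: cmap_def emap_def)
  then show ?case by blast
next
  case (Suc m)
  then obtain R f where f: "cmap R i n m f" by (meson less_SucI)
  from emap_fill_homology[OF emap_cmap_boundary[OF f] Suc.prems[OF lessI]] obtain R' E where
    E: "emap R' (Suc m) i (Suc m) (n (Suc m)) E"
      "\<forall>c\<in>chains (Suc m) i. boundary (Suc m) (E c) = f m (boundary (Suc m) c)"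
    by blast
  have "cmap (min R R') i n (Suc m) (f(Suc m := E))"
    by (rule cmap_extend[OF cmap_mono[OF f] emap_mono[OF E(1)] E(2)]) auto
  then show ?case by blast
qed

text \<open>Only the behaviour of a homotopy on cycles is recorded; this already suffices to construct
  the homotopy one degree further up.\<close>

definition homotopy_on_cycles ::
    "nat \<Rightarrow> real \<Rightarrow> ('a vr_chain \<Rightarrow> 'a vr_chain) \<Rightarrow> ('a vr_chain \<Rightarrow> 'a vr_chain) \<Rightarrow> bool" where
  "homotopy_on_cycles p i f H \<longleftrightarrow>
     (\<forall>z \<in> chains p i. boundary p z = 0 \<longrightarrow> boundary (Suc p) (H z) = z - f z)"

lemma homotopy_on_cyclesD:
  "homotopy_on_cycles p i f H \<Longrightarrow> z \<in> chains p i \<Longrightarrow> boundary p z = 0 \<Longrightarrow>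
    boundary (Suc p) (H z) = z - f z"
  unfolding homotopy_on_cycles_def by blast

lemma homotopy_defect_0:
  assumes f: "cmap R i s m f" and "i \<le> a" "s 0 \<le> a" "R \<le> 0"
  shows "emap R 0 i 0 a (\<lambda>c. c - f 0 c)"
    and "\<forall>c\<in>chains 0 i. boundary 0 (c - f 0 c) = 0"
proof -
  show "emap R 0 i 0 a (\<lambda>c. c - f 0 c)"
    by (intro emap_minus emap_mono[OF emap_ident] emap_mono[OF cmap_emap[OF f]]) (use assms in auto)
  show "\<forall>c\<in>chains 0 i. boundary 0 (c - f 0 c) = 0"
    using cmap_boundary_0[OF f] by (simp add: boundary_diff)
qed

lemma homotopy_defect_Suc:
  assumes f: "cmap R i s m f" and p: "Suc p \<le> m"
    and H: "emap R p i (Suc p) a H" "homotopy_on_cycles p i (f p) H"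
    and "i \<le> a" "s (Suc p) \<le> a" "R \<le> 0"
  shows "emap R (Suc p) i (Suc p) a (\<lambda>c. c - f (Suc p) c - H (boundary (Suc p) c))"
    and "\<forall>c\<in>chains (Suc p) i. boundary (Suc p) (c - f (Suc p) c - H (boundary (Suc p) c)) = 0"
proof -
  show "emap R (Suc p) i (Suc p) a (\<lambda>c. c - f (Suc p) c - H (boundary (Suc p) c))"
    by (intro emap_minus emap_mono[OF emap_ident] emap_mono[OF cmap_emap[OF f p]]
        emap_mono[OF emap_comp[OF emap_boundary H(1)]]) (use assms in auto)
  show "\<forall>c\<in>chains (Suc p) i. boundary (Suc p) (c - f (Suc p) c - H (boundary (Suc p) c)) = 0"
  proof
    fix c assume c: "c \<in> chains (Suc p) i"
    show "boundary (Suc p) (c - f (Suc p) c - H (boundary (Suc p) c)) = 0"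
      using cmap_boundary[OF f p c]
        homotopy_on_cyclesD[OF H(2) boundary_in_vr_chains[OF c] boundary_boundary]
      by (simp add: boundary_diff)
  qed
qed

lemma homotopy_on_cycles_Suc:
  assumes "\<forall>c\<in>chains (Suc p) i. boundary (Suc (Suc p)) (E c) = c - f c - H (boundary (Suc p) c)" and "H 0 = 0"
  shows "homotopy_on_cycles (Suc p) i f E"
  using assms unfolding homotopy_on_cycles_def by (simp del: carrier_free_Abelian_group_iff)

lemma cone_homotopy:
  assumes f: "cmap 0 i s m f"
  shows "p \<le> m \<Longrightarrow> \<exists>b H. emap 0 p i (Suc p) b H \<and> homotopy_on_cycles p i (f p) H"
proof (induction p)
  case 0
  have F: "emap 0 0 i 0 (max i (s 0)) (\<lambda>c. c - f 0 c)"
    "\<forall>c\<in>chains 0 i. boundary 0 (c - f 0 c) = 0"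
    by (rule homotopy_defect_0[OF f, of "max i (s 0)"]; simp del: carrier_free_Abelian_group_iff)+
  from emap_fill_cone[OF F] obtain b E where
    "emap 0 0 i (Suc 0) b E" "\<forall>c\<in>chains 0 i. boundary (Suc 0) (E c) = c - f 0 c"
    by blast
  then show ?case
    unfolding homotopy_on_cycles_def by blast
next
  case (Suc p)
  then obtain b H where H: "emap 0 p i (Suc p) b H" "homotopy_on_cycles p i (f p) H"
    by auto
  let ?a = "max b (max i (s (Suc p)))"
  have H': "emap 0 p i (Suc p) ?a H"
    by (rule emap_mono[OF H(1)]) auto
  have F: "emap 0 (Suc p) i (Suc p) ?a (\<lambda>c. c - f (Suc p) c - H (boundary (Suc p) c))"
    "\<forall>c\<in>chains (Suc p) i. boundary (Suc p) (c - f (Suc p) c - H (boundary (Suc p) c)) = 0"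
    by (rule homotopy_defect_Suc[OF f Suc.prems H' H(2)];
        simp del: carrier_free_Abelian_group_iff)+
  from emap_fill_cone[OF F] obtain b' E where "emap 0 (Suc p) i (Suc (Suc p)) b' E"
    "\<forall>c\<in>chains (Suc p) i. boundary (Suc (Suc p)) (E c) = c - f (Suc p) c - H (boundary (Suc p) c)"
    by blast
  then show ?case
    using homotopy_on_cycles_Suc emap_zero[OF H(1)] by blast
qed

lemma homology_homotopy:
  assumes f: "cmap R i s m f" and s: "\<And>p. p \<le> m \<Longrightarrow> s p \<le> i" and i: "0 \<le> i"
    and \<mu>: "\<And>q a. q \<le> m \<Longrightarrow> 0 \<le> a \<Longrightarrow> homology_vanishes (carrier G) d q a (\<mu> a)"
  shows "p \<le> m \<Longrightarrow> \<exists>R H. R \<le> 0 \<and> i \<le> (\<mu> ^^ Suc p) i \<and>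
    emap R p i (Suc p) ((\<mu> ^^ Suc p) i) H \<and> homotopy_on_cycles p i (f p) H"
proof (induction p)
  case 0
  have f': "cmap (min R 0) i s m f" by (rule cmap_mono[OF f]) auto
  have F: "emap (min R 0) 0 i 0 i (\<lambda>c. c - f 0 c)"
    "\<forall>c\<in>chains 0 i. boundary 0 (c - f 0 c) = 0"
    by (rule homotopy_defect_0[OF f', of i]; use s in \<open>simp del: carrier_free_Abelian_group_iff\<close>)+
  from emap_fill_homology[OF F \<mu>[OF le0 i]] obtain R' E where
    E: "emap R' 0 i (Suc 0) (\<mu> i) E" "\<forall>c\<in>chains 0 i. boundary (Suc 0) (E c) = c - f 0 c"
    by blast
  have "emap (min R' 0) 0 i (Suc 0) (\<mu> i) E" by (rule emap_mono[OF E(1)]) auto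
  moreover have "i \<le> \<mu> i" using \<mu>[OF le0 i] by (simp add: homology_vanishes_def)
  ultimately show ?case
    using E(2) unfolding homotopy_on_cycles_def by (intro exI[of _ "min R' 0"] exI[of _ E]) (simp del: carrier_free_Abelian_group_iff)
next
  case (Suc p)
  let ?a = "(\<mu> ^^ Suc p) i"
  from Suc obtain R' H where R': "R' \<le> 0" and a: "i \<le> ?a"
    and H: "emap R' p i (Suc p) ?a H" "homotopy_on_cycles p i (f p) H"
    by auto
  let ?R = "min R R'"
  have f': "cmap ?R i s m f" by (rule cmap_mono[OF f]) auto
  have H': "emap ?R p i (Suc p) ?a H" by (rule emap_mono[OF H(1)]) auto
  have van: "homology_vanishes (carrier G) d (Suc p) ?a (\<mu> ?a)"
    using Suc.prems i a by (intro \<mu>) auto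
  have F: "emap ?R (Suc p) i (Suc p) ?a (\<lambda>c. c - f (Suc p) c - H (boundary (Suc p) c))"
    "\<forall>c\<in>chains (Suc p) i. boundary (Suc p) (c - f (Suc p) c - H (boundary (Suc p) c)) = 0"
    by (rule homotopy_defect_Suc[OF f' Suc.prems H' H(2) a order_trans[OF s[OF Suc.prems] a]];
        use R' in \<open>simp del: carrier_free_Abelian_group_iff\<close>)+
  from emap_fill_homology[OF F van] obtain R'' E where E: "emap R'' (Suc p) i (Suc (Suc p)) (\<mu> ?a) E"
    "\<forall>c\<in>chains (Suc p) i. boundary (Suc (Suc p)) (E c) = c - f (Suc p) c - H (boundary (Suc p) c)"
    by blast
  have "emap (min R'' 0) (Suc p) i (Suc (Suc p)) (\<mu> ?a) E" by (rule emap_mono[OF E(1)]) auto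
  moreover have "homotopy_on_cycles (Suc p) i (f (Suc p)) E"
    using homotopy_on_cycles_Suc[OF E(2) emap_zero[OF H(1)]] .
  moreover have "i \<le> \<mu> ?a" using van a by (simp add: homology_vanishes_def)
  ultimately show ?case
    by (intro exI[of _ "min R'' 0"] exI[of _ E]) simp
qed

lemma cmap_restrict: "cmap R i s m f \<Longrightarrow> m' \<le> m \<Longrightarrow> cmap R i s m' f"
  unfolding cmap_def by simp

lemma cmap_funpow:
  assumes "cmap \<delta> k (\<lambda>_. k) m f"
  shows "cmap (real N * \<delta>) k (\<lambda>_. k) m (\<lambda>p. f p ^^ N)"
proof (induction N)
  case 0
  show ?case by (simp add: cmap_def emap_ident id_def del: carrier_free_Abelian_group_iff)
next
  case (Suc N)
  show ?case
    using cmap_comp[OF Suc assms] by (simp add: algebra_simps o_def)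
qed

section \<open>A valuation-raising chain map makes the half space of type FP\<close>

lemma type_FP_superlevel:
  assumes \<phi>: "cmap \<delta> k (\<lambda>_. k) m \<phi>" and \<delta>: "0 < \<delta>"
    and van: "\<And>q. q < m \<Longrightarrow> homology_vanishes (carrier G) d q (n q) (n (Suc q))"
    and n: "0 \<le> n 0" "\<And>q. q \<le> m \<Longrightarrow> n q \<le> k"
  shows "type_FP m (superlevel G \<chi> 0) d"
  unfolding type_FP_def
proof (intro allI impI)
  fix q i assume q: "q < m" and "(0::real) \<le> i"
  let ?X = "superlevel G \<chi> 0"
  obtain R f where f: "cmap R i n m f"
    using cmap_retract[of m n i, OF van n(1)] by blast
  have fk: "cmap R i (\<lambda>_. k) m f"
    by (rule cmap_mono[OF f order_refl n(2)])
  obtain N where "- R < real N * \<delta>"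
    using reals_Archimedean3[OF \<delta>] by blast
  then have N: "0 \<le> R + real N * \<delta>" by simp
  let ?\<psi> = "\<lambda>p c. (\<phi> p ^^ N) (f p c)"
  have \<psi>: "cmap 0 i (\<lambda>_. k) m ?\<psi>"
    by (rule cmap_mono[OF cmap_comp[OF fk cmap_funpow[OF \<phi>, of N]] N]) simp
  have \<phi>0: "cmap 0 k (\<lambda>_. k) m \<phi>"
    by (rule cmap_mono[OF \<phi>]) (use \<delta> in auto)
  obtain b1 H1 where H1: "emap 0 q i (Suc q) b1 H1" "homotopy_on_cycles q i (?\<psi> q) H1"
    using cone_homotopy[OF \<psi> less_imp_le[OF q]] by blast
  obtain b2 H2 where H2: "emap 0 q k (Suc q) b2 H2" "homotopy_on_cycles q k (\<phi> q) H2"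
    using cone_homotopy[OF \<phi>0 less_imp_le[OF q]] by blast
  define j where "j = max (max b1 b2) (max i k)"
  have bd: "boundary (Suc q) e \<in> boundaries ?X d q j"
    if "e \<in> chains_above L (Suc q) b" "0 \<le> L" "b \<le> j" for e L b
    unfolding mem_boundaries by (rule bexI[OF refl chains_above_antimono[OF that]])
  have "homology_vanishes ?X d q i j"
    unfolding homology_vanishes_iff
  proof (intro conjI subsetI)
    show "i \<le> j" by (simp add: j_def)
    fix z assume "z \<in> cycles ?X d q i"
    then have z: "z \<in> chains_above 0 q i" "z \<in> chains q i" "boundary q z = 0"
      using chains_above_subset by (auto simp only: mem_cycles)
    let ?w = "?\<psi> q z"
    have w: "?w \<in> chains_above 0 q k" "boundary q ?w = 0"
      using emap_above[OF cmap_emap[OF \<psi> less_imp_le[OF q]] z(1)]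
        cmap_cycle[OF \<psi> less_imp_le[OF q] z(2,3)] by simp_all
    have "z - ?w \<in> boundaries ?X d q j"
      using bd[OF emap_above[OF H1(1) z(1)]] homotopy_on_cyclesD[OF H1(2) z(2,3)]
      by (simp add: j_def)
    moreover have "?w - (\<phi> q ^^ l) ?w \<in> boundaries ?X d q j" for l
    proof (induction l)
      case 0
      show ?case using boundaries_zero by simp
    next
      case (Suc l)
      let ?u = "(\<phi> q ^^ l) ?w"
      have \<phi>l: "cmap 0 k (\<lambda>_. k) m (\<lambda>p. \<phi> p ^^ l)"
        using cmap_funpow[OF \<phi>0, of l] by simp
      have u: "?u \<in> chains_above 0 q k" "boundary q ?u = 0"
        using emap_above[OF cmap_emap[OF \<phi>l less_imp_le[OF q]] w(1)]
          cmap_cycle[OF \<phi>l less_imp_le[OF q] chains_above_subset[OF w(1)] w(2)] by simp_all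
      have "?u - \<phi> q ?u \<in> boundaries ?X d q j"
        using bd[OF emap_above[OF H2(1) u(1)]]
          homotopy_on_cyclesD[OF H2(2) chains_above_subset[OF u(1)] u(2)]
        by (simp add: j_def)
      from boundaries_add[OF Suc this] show ?case by simp
    qed
    moreover have "\<exists>l. (\<phi> q ^^ l) ?w \<in> boundaries ?X d q j"
    proof -
      have "f q z \<in> chains q (n q)" "boundary q (f q z) = 0"
        using emap_closed[OF cmap_emap[OF f less_imp_le[OF q]] z(2)]
          cmap_cycle[OF f less_imp_le[OF q] z(2,3)] .
      with van[OF q] obtain c where "c \<in> chains (Suc q) (n (Suc q))" and
        c: "boundary (Suc q) c = f q z"
        by (rule homology_vanishesD)
      then have ck: "c \<in> chains (Suc q) k"
        using vr_chains_mono[OF order_refl n(2)[OF Suc_leI[OF q]]] by blast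
      from chains_bounded_below[OF ck] obtain L where L: "c \<in> chains_above L (Suc q) k" ..
      obtain l where "- L < real l * \<delta>"
        using reals_Archimedean3[OF \<delta>] by blast
      moreover have "0 \<le> real N * \<delta>" using \<delta> by simp
      ultimately have l: "0 \<le> L + real (l + N) * \<delta>"
        by (simp add: algebra_simps)
      note \<phi>M = cmap_funpow[OF \<phi>, of "l + N"]
      have "boundary (Suc q) ((\<phi> (Suc q) ^^ (l + N)) c) \<in> boundaries ?X d q j"
        by (rule bd[OF emap_above[OF cmap_emap[OF \<phi>M Suc_leI[OF q]] L] l]) (simp add: j_def)
      moreover have "boundary (Suc q) ((\<phi> (Suc q) ^^ (l + N)) c) = (\<phi> q ^^ l) ?w"
        using cmap_boundary[OF \<phi>M Suc_leI[OF q] ck] by (simp add: c funpow_add)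
      ultimately show ?thesis by auto
    qed
    ultimately obtain l where l: "z - ?w \<in> boundaries ?X d q j"
      "?w - (\<phi> q ^^ l) ?w \<in> boundaries ?X d q j" "(\<phi> q ^^ l) ?w \<in> boundaries ?X d q j"
      by blast
    have "z = (z - ?w) + (?w - (\<phi> q ^^ l) ?w) + (\<phi> q ^^ l) ?w" by simp
    then show "z \<in> boundaries ?X d q j"
      using boundaries_add[OF boundaries_add[OF l(1,2)] l(3)] by metis
  qed
  then show "\<exists>j\<ge>i. homology_vanishes ?X d q i j"
    by (auto simp: homology_vanishes_def)
qed

section \<open>A valuation-raising chain map on a half space of type FP\<close>

lemma character_int_pow: "g \<in> carrier G \<Longrightarrow> \<chi> (g [^] (z::int)) = of_int z * \<chi> g"
  by (cases z rule: int_cases2) (simp_all add: int_pow_int int_pow_neg character_inv character_pow)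

text \<open>The bounding chain found by type FP lives at a larger scale, so it is retracted; a homotopy
  at scale \<open>n (Suc q)\<close> compensates for what the retraction does to the cycle itself.\<close>

lemma lossy_filling:
  assumes FP: "type_FP m (superlevel G \<chi> 0) d"
    and t: "t \<in> carrier G" "0 < \<chi> t"
    and \<mu>: "\<And>q a. q < m \<Longrightarrow> 0 \<le> a \<Longrightarrow> homology_vanishes (carrier G) d q a (\<mu> a)"
    and van: "\<And>q. q < m \<Longrightarrow> homology_vanishes (carrier G) d q (n q) (n (Suc q))"
    and n: "0 \<le> n 0" "\<And>q. q < m \<Longrightarrow> (\<mu> ^^ Suc q) (n q) \<le> n (Suc q)"
    and mono: "\<And>p q. p \<le> q \<Longrightarrow> q \<le> m \<Longrightarrow> n p \<le> n q"
  obtains D where "0 \<le> D"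
    "\<And>q L z. q < m \<Longrightarrow> z \<in> chains_above L q (n q) \<Longrightarrow> boundary q z = 0 \<Longrightarrow>
      \<exists>c \<in> chains_above (L - D) (Suc q) (n (Suc q)). boundary (Suc q) c = z"
proof -
  define P where "P q D \<longleftrightarrow> (\<forall>L. \<forall>z \<in> chains_above L q (n q). boundary q z = 0 \<longrightarrow>
      (\<exists>c \<in> chains_above (L - D) (Suc q) (n (Suc q)). boundary (Suc q) c = z))" for q D
  have "\<forall>q \<in> {..<m}. eventually (P q) at_top"
  proof
    fix q assume "q \<in> {..<m}"
    then have q: "q < m" by simp
    have nq: "0 \<le> n q" using mono[of 0 q] n(1) q by simp
    obtain j where j: "n q \<le> j" "homology_vanishes (superlevel G \<chi> 0) d q (n q) j"
      using FP q nq unfolding type_FP_def by blast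
    obtain R \<beta> where \<beta>: "cmap R j n m \<beta>"
      using cmap_retract[of m n j, OF van n(1)] by blast
    have \<beta>': "cmap R (n q) n q \<beta>"
      by (rule cmap_restrict[OF cmap_source_mono[OF \<beta> j(1)] less_imp_le[OF q]])
    have "\<exists>R' H. R' \<le> 0 \<and> n q \<le> (\<mu> ^^ Suc q) (n q) \<and>
      emap R' q (n q) (Suc q) ((\<mu> ^^ Suc q) (n q)) H \<and> homotopy_on_cycles q (n q) (\<beta> q) H"
      by (rule homology_homotopy[OF \<beta>' _ nq]) (use mono \<mu> q in auto)
    then obtain R' H where H: "emap R' q (n q) (Suc q) ((\<mu> ^^ Suc q) (n q)) H"
      "homotopy_on_cycles q (n q) (\<beta> q) H"
      by blast
    have "P q D" if D: "\<chi> t + \<bar>R\<bar> + \<bar>R'\<bar> \<le> D" for D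
      unfolding P_def
    proof (intro allI ballI impI)
      fix L z assume z: "z \<in> chains_above L q (n q)" "boundary q z = 0"
      define g where "g = t [^] \<lfloor>L / \<chi> t\<rfloor>"
      have g: "g \<in> carrier G" unfolding g_def using t(1) by simp
      have "of_int \<lfloor>L / \<chi> t\<rfloor> * \<chi> t \<le> L"
        using mult_right_mono[OF of_int_floor_le[of "L / \<chi> t"], of "\<chi> t"] t(2) by simp
      moreover have "L - \<chi> t \<le> of_int \<lfloor>L / \<chi> t\<rfloor> * \<chi> t"
      proof -
        have "L / \<chi> t \<le> of_int \<lfloor>L / \<chi> t\<rfloor> + 1" by linarith
        from mult_right_mono[OF this, of "\<chi> t"] show ?thesis using t(2) by (simp add: algebra_simps)
      qed
      ultimately have g\<chi>: "L - \<chi> t \<le> \<chi> g" "\<chi> g \<le> L"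
        unfolding g_def using character_int_pow[OF t(1)] by simp_all
      have "translate G (inv g) z \<in> chains_above (L + \<chi> (inv g)) q (n q)"
        by (rule translate_in_chains_above[OF z(1)]) (use g in simp)
      then have "translate G (inv g) z \<in> chains_above 0 q (n q)"
        by (rule chains_above_antimono) (use g g\<chi> in \<open>simp_all add: character_inv\<close>)
      moreover have "boundary q (translate G (inv g) z) = 0"
        by (simp add: boundary_translate z(2))
      ultimately obtain c where c: "c \<in> chains_above 0 (Suc q) j"
        "boundary (Suc q) c = translate G (inv g) z"
        by (rule homology_vanishesD[OF j(2)])
      have zz: "translate G g (translate G (inv g) z) = z"
        using translate_translate[OF chains_above_subset[OF z(1)] g, of "inv g"] g
          translate_one[OF chains_above_subset[OF z(1)]] by simp
      let ?c = "translate G g c"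
      have c': "?c \<in> chains_above (L - \<chi> t) (Suc q) j"
        by (rule chains_above_antimono[OF translate_in_chains_above[OF c(1) g]]) (use g\<chi> in auto)
      have bc: "boundary (Suc q) ?c = z"
        by (simp add: boundary_translate c(2) zz)
      let ?y = "\<beta> (Suc q) ?c + H z"
      have "\<beta> (Suc q) ?c \<in> chains_above (L - D) (Suc q) (n (Suc q))"
        by (rule chains_above_antimono[OF emap_above[OF cmap_emap[OF \<beta> Suc_leI[OF q]] c']])
          (use D in auto)
      moreover have "H z \<in> chains_above (L - D) (Suc q) (n (Suc q))"
        by (rule chains_above_antimono[OF emap_above[OF H(1) z(1)]]) (use D t(2) n(2)[OF q] in auto)
      ultimately have "?y \<in> chains_above (L - D) (Suc q) (n (Suc q))"
        by (rule vr_chains_add)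
      moreover have "boundary (Suc q) ?y = z"
        using cmap_boundary[OF \<beta> Suc_leI[OF q] chains_above_subset[OF c']]
          homotopy_on_cyclesD[OF H(2) chains_above_subset[OF z(1)] z(2)]
        by (simp add: boundary_add bc)
      ultimately show "\<exists>c \<in> chains_above (L - D) (Suc q) (n (Suc q)). boundary (Suc q) c = z"
        by blast
    qed
    then show "eventually (P q) at_top"
      unfolding eventually_at_top_linorder by blast
  qed
  then have "eventually (\<lambda>D. \<forall>q \<in> {..<m}. P q D) at_top"
    by (intro eventually_ball_finite) auto
  then have "eventually (\<lambda>D. 0 \<le> D \<and> (\<forall>q \<in> {..<m}. P q D)) at_top"
    using eventually_ge_at_top by (rule eventually_conj[rotated])
  then obtain D where D: "0 \<le> D" "\<forall>q \<in> {..<m}. P q D"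
    unfolding eventually_at_top_linorder by blast
  show thesis
    by (rule that[OF D(1)]) (use D(2) in \<open>auto simp: P_def simp del: carrier_free_Abelian_group_iff\<close>)
qed

abbreviation vertex_value :: "'a \<Rightarrow> 'a list \<Rightarrow> 'a vr_chain" where
  "vertex_value g \<equiv> (\<lambda>_. 0)([\<one>] := frag_of [g])"

abbreviation vertex_map :: "'a \<Rightarrow> 'a vr_chain \<Rightarrow> 'a vr_chain" where
  "vertex_map g \<equiv> linear_extension G (vertex_value g)"

lemma base_simplices_0: "x \<in> base_simplices G S 0 k \<Longrightarrow> x = [\<one>]"
  unfolding base_simplices_def mem_simplices by (auto simp: length_Suc_conv)

lemma vertex_in_chains_above:
  "g \<in> carrier G \<Longrightarrow> 0 \<le> b \<Longrightarrow> frag_of [g] \<in> chains_above (\<chi> g) 0 b"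
  by (simp add: keys_frag_of mem_simplices superlevel_def d_self)

lemma vertex_value_above:
  assumes "g \<in> carrier G" "0 \<le> b" "x \<in> base_simplices G S 0 i"
  shows "vertex_value g x \<in> chains_above (simplex_val \<chi> x + \<chi> g) 0 b"
  using vertex_in_chains_above[OF assms(1,2)] base_simplices_0[OF assms(3)]
  by (simp add: simplex_val_def character_one)

lemma emap_vertex_map: "g \<in> carrier G \<Longrightarrow> 0 \<le> b \<Longrightarrow> emap (\<chi> g) 0 i 0 b (vertex_map g)"
  by (rule emap_linear_extension(1)) (rule vertex_value_above)

lemma vertex_map_base:
  "g \<in> carrier G \<Longrightarrow> x \<in> base_simplices G S 0 i \<Longrightarrow> vertex_map g (frag_of x) = frag_of [g]"
  using emap_linear_extension(2)[OF vertex_value_above[of g 0]] base_simplices_0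
  by fastforce

lemma cmap_vertex_map:
  assumes "g \<in> carrier G" "0 \<le> s 0"
  shows "cmap (\<chi> g) i s 0 (\<lambda>_. vertex_map g)"
proof -
  have "boundary 0 (vertex_map g c) = boundary 0 c" if "c \<in> chains 0 i" for c
  proof (rule emap_eqI[OF _ _ _ that])
    fix x h assume x: "x \<in> base_simplices G S 0 i" and h: "h \<in> carrier G"
    show "boundary 0 (vertex_map g (frag_of (map (\<lambda>y. h \<otimes> y) x))) =
        boundary 0 (frag_of (map (\<lambda>y. h \<otimes> y) x))"
      using base_simplices_0[OF x] linear_extension_translate_base[OF x h, of "vertex_value g"]
      by (simp add: boundary_0_frag_of translate_frag_of)
  qed (simp_all only: linear_extension_diff boundary_diff)
  then show ?thesis
    using emap_vertex_map[OF assms] by (simp add: cmap_def)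
qed

lemma cmap_raise:
  assumes D: "0 \<le> D" "\<And>q L z. q < m \<Longrightarrow> z \<in> chains_above L q (n q) \<Longrightarrow> boundary q z = 0 \<Longrightarrow>
      \<exists>c \<in> chains_above (L - D) (Suc q) (n (Suc q)). boundary (Suc q) c = z"
    and g: "g \<in> carrier G" and n: "0 \<le> n 0"
  shows "\<exists>f. cmap (\<chi> g - real m * D) i n m f \<and> f 0 = vertex_map g"
  using D(2)
proof (induction m)
  case 0
  show ?case using cmap_vertex_map[where s = n, OF g n, of i]
    by (intro exI[of _ "\<lambda>_. vertex_map g"]) (simp del: fun_upd_apply)
next
  case (Suc m)
  have "\<exists>f. cmap (\<chi> g - real m * D) i n m f \<and> f 0 = vertex_map g"
    by (rule Suc.IH) (rule Suc.prems, simp_all del: carrier_free_Abelian_group_iff)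
  then obtain f where f: "cmap (\<chi> g - real m * D) i n m f" "f 0 = vertex_map g"
    by blast
  let ?R = "\<chi> g - real (Suc m) * D"
  note F = emap_cmap_boundary[OF f(1)]
  have "\<exists>y \<in> chains_above (simplex_val \<chi> x + ?R) (Suc m) (n (Suc m)).
      boundary (Suc m) y = f m (boundary (Suc m) (frag_of x))"
    if x: "x \<in> base_simplices G S (Suc m) i" for x
  proof -
    have xc: "frag_of x \<in> chains (Suc m) i"
      using base_simplexD(1)[OF x] by (simp add: keys_frag_of)
    have "simplex_val \<chi> x + (\<chi> g - real m * D) - D = simplex_val \<chi> x + ?R"
      by (simp add: algebra_simps)
    with Suc.prems[OF lessI emap_base[OF F(1) x] bspec[OF F(2) xc]] show ?thesis by simp
  qed
  from emap_fill[OF F(1) this] obtain E where E: "emap ?R (Suc m) i (Suc m) (n (Suc m)) E"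
    "\<forall>c\<in>chains (Suc m) i. boundary (Suc m) (E c) = f m (boundary (Suc m) c)"
    by blast
  have "cmap ?R i n m f"
    by (rule cmap_mono[OF f(1)]) (use D(1) in \<open>auto simp: algebra_simps\<close>)
  from cmap_extend[where s = n, OF this E] have "cmap ?R i n (Suc m) (f(Suc m := E))" .
  moreover have "(f(Suc m := E)) 0 = vertex_map g"
    by (subst fun_upd_other) (simp, rule f(2))
  ultimately show ?case by blast
qed

lemma power_path:
  assumes t: "t \<in> letters" "0 < \<chi> t" and k: "1 \<le> k"
  shows "\<exists>y \<in> chains_above (\<chi> t) (Suc 0) k.
    boundary (Suc 0) y = frag_of [t [^] Suc r] - frag_of [t]"
proof (induction r)
  case 0
  have "t \<in> carrier G" using t(1) letters_subset by blast
  then show ?case by (intro bexI[of _ 0]) (simp_all add: vr_chains_zero)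
next
  case (Suc r)
  have tc: "t \<in> carrier G" using t(1) letters_subset by blast
  from Suc obtain y where y: "y \<in> chains_above (\<chi> t) (Suc 0) k"
    "boundary (Suc 0) y = frag_of [t [^] Suc r] - frag_of [t]"
    by blast
  define a where "a = t [^] Suc r"
  have a: "a \<in> carrier G" "\<chi> t \<le> \<chi> a"
    unfolding a_def using tc t(2) character_pow[OF tc, of "Suc r"]
    by (simp_all del: nat_pow_Suc add: algebra_simps)
  have "a \<otimes> t = t [^] Suc (Suc r)" by (simp add: a_def)
  moreover have "frag_of [a, a \<otimes> t] \<in> chains_above (\<chi> t) (Suc 0) k"
    using a tc t k d_mult_letter[OF t(1) a(1)]
    by (simp add: keys_frag_of mem_simplices superlevel_def character_mult d_self)
  moreover have "boundary (Suc 0) (frag_of [a, a \<otimes> t]) = frag_of [a \<otimes> t] - frag_of [a]"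
    by (simp add: boundary_frag_of_Cons boundary_0_frag_of vcone_def)
  ultimately show ?case
    using y by (intro bexI[of _ "y + frag_of [a, a \<otimes> t]"])
      (simp_all only: boundary_add vr_chains_add a_def, simp)
qed

text \<open>The loss \<open>m * D\<close> is absorbed by starting from a high power \<open>t\<^sup>r\<close> of a generator \<open>t\<close>.
  Replacing \<open>t\<^sup>r\<close> by \<open>t\<close> afterwards changes the chain map only in the degrees \<open>0\<close> and \<open>1\<close>, by the
  homotopy which runs from \<open>t\<close> to \<open>t\<^sup>r\<close> through the powers of \<open>t\<close>, that is, without loss and
  within scale \<open>1\<close>.\<close>

lemma exists_raising_cmap:
  assumes FP: "type_FP m (superlevel G \<chi> 0) d"
    and t: "t \<in> letters" "0 < \<chi> t"
    and \<mu>: "\<And>q a. q < m \<Longrightarrow> 0 \<le> a \<Longrightarrow> homology_vanishes (carrier G) d q a (\<mu> a)"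
    and van: "\<And>q. q < m \<Longrightarrow> homology_vanishes (carrier G) d q (n q) (n (Suc q))"
    and n: "0 \<le> n 0" "\<And>q. q < m \<Longrightarrow> (\<mu> ^^ Suc q) (n q) \<le> n (Suc q)"
    and mono: "\<And>p q. p \<le> q \<Longrightarrow> q \<le> m \<Longrightarrow> n p \<le> n q"
    and k: "1 \<le> k" "\<And>q. q \<le> m \<Longrightarrow> n q \<le> k"
  shows "\<exists>\<phi>. cmap (\<chi> t) k (\<lambda>_. k) m \<phi> \<and> \<phi> 0 = vertex_map t"
proof -
  have tc: "t \<in> carrier G" using t(1) letters_subset by blast
  obtain D where D: "0 \<le> D"
    "\<And>q L z. q < m \<Longrightarrow> z \<in> chains_above L q (n q) \<Longrightarrow> boundary q z = 0 \<Longrightarrow>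
      \<exists>c \<in> chains_above (L - D) (Suc q) (n (Suc q)). boundary (Suc q) c = z"
    using lossy_filling[OF FP tc t(2) \<mu> van n mono] by blast
  obtain r where "real m * D < real r * \<chi> t"
    using reals_Archimedean3[OF t(2)] by blast
  then have r: "\<chi> t \<le> \<chi> (t [^] Suc r) - real m * D"
    using character_pow[OF tc, of "Suc r"] by (simp add: algebra_simps del: nat_pow_Suc)
  let ?s = "t [^] Suc r"
  have sc: "?s \<in> carrier G" using tc by simp
  have "\<exists>f. cmap (\<chi> ?s - real m * D) k n m f \<and> f 0 = vertex_map ?s"
    by (rule cmap_raise[OF D sc n(1)])
  then obtain f where f': "cmap (\<chi> ?s - real m * D) k n m f" and f0: "f 0 = vertex_map ?s"
    by blast
  have f: "cmap (\<chi> t) k (\<lambda>_. k) m f"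
    by (intro cmap_mono[OF f' r] k(2))
  have k0: "0 \<le> k" using k(1) by simp
  have \<chi>s: "\<chi> t \<le> \<chi> ?s"
    using r D(1) by (smt (verit) of_nat_0_le_iff zero_le_mult_iff)
  let ?F = "\<lambda>c. vertex_map ?s c - vertex_map t c"
  have F: "emap (\<chi> t) 0 k 0 k ?F"
    by (intro emap_minus emap_vertex_map[OF tc k0] emap_mono[OF emap_vertex_map[OF sc k0] \<chi>s order_refl])
  have "\<exists>y \<in> chains_above (simplex_val \<chi> x + \<chi> t) (Suc 0) k. boundary (Suc 0) y = ?F (frag_of x)"
    if x: "x \<in> base_simplices G S 0 k" for x
    using power_path[OF t k(1), of r] base_simplices_0[OF x] vertex_map_base[OF tc x]
      vertex_map_base[OF sc x]
    by (simp add: simplex_val_def character_one del: carrier_free_Abelian_group_iff nat_pow_Suc)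
  from emap_fill[OF F this] obtain h where h: "emap (\<chi> t) 0 k (Suc 0) k h"
    "\<forall>c\<in>chains 0 k. boundary (Suc 0) (h c) = ?F c"
    by blast
  define \<phi> where "\<phi> p = (if p = 0 then vertex_map t
      else if p = Suc 0 then (\<lambda>c. f (Suc 0) c - h (boundary (Suc 0) c)) else f p)" for p
  have "cmap (\<chi> t) k (\<lambda>_. k) m \<phi>"
    unfolding cmap_def
  proof (intro conjI allI impI ballI)
    show "emap (\<chi> t) p k p k (\<phi> p)" if "p \<le> m" for p
    proof -
      have "emap (\<chi> t) (Suc 0) k (Suc 0) k (\<lambda>c. f (Suc 0) c - h (boundary (Suc 0) c))" if "p = Suc 0"
        using emap_comp[OF emap_boundary h(1)] cmap_emap[OF f \<open>p \<le> m\<close>] that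
        by (intro emap_minus) simp_all
      then show ?thesis
        using emap_vertex_map[OF tc k0] cmap_emap[OF f that] by (simp add: \<phi>_def)
    qed
    show "boundary 0 (\<phi> 0 c) = boundary 0 c" if "c \<in> chains 0 k" for c
      using cmap_boundary_0[OF cmap_vertex_map[where s = "\<lambda>_. 0", OF tc order_refl] that] by (simp add: \<phi>_def)
    show "boundary (Suc p) (\<phi> (Suc p) c) = \<phi> p (boundary (Suc p) c)"
      if p: "p < m" and c: "c \<in> chains (Suc p) k" for p c
    proof -
      have fp: "boundary (Suc p) (f (Suc p) c) = f p (boundary (Suc p) c)"
        by (rule cmap_boundary[OF f Suc_leI[OF p] c])
      consider "p = 0" | "p = Suc 0" | "Suc 0 < p" by linarith
      then show ?thesis
      proof cases
        case 1
        then have "boundary (Suc 0) (h (boundary (Suc 0) c)) = ?F (boundary (Suc 0) c)"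
          using h(2) boundary_in_vr_chains c by blast
        then show ?thesis using fp 1 by (simp add: \<phi>_def boundary_diff f0)
      next
        case 2
        then show ?thesis using fp emap_zero[OF h(1)] by (simp add: \<phi>_def)
      next
        case 3
        then show ?thesis using fp by (simp add: \<phi>_def)
      qed
    qed
  qed
  then show ?thesis by (auto simp: \<phi>_def)
qed

section \<open>Valuations and chain endomorphisms\<close>

lemma chain_val_le:
  assumes "c \<in> chains_above L q k"
  shows "ereal L \<le> chain_val \<chi> c"
proof (cases "c = 0")
  case False
  then show ?thesis
    using assms by (auto simp: chain_val_def mem_simplices_superlevel subset_iff)
qed (simp add: chain_val_def)

lemma chains_above_chain_val:
  assumes "c \<in> chains q k" "c \<noteq> 0"
  obtains L where "chain_val \<chi> c = ereal L" "c \<in> chains_above L q k"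
proof
  show "chain_val \<chi> c = ereal (Min (simplex_val \<chi> ` Poly_Mapping.keys c))"
    using assms(2) by (simp add: chain_val_def)
  show "c \<in> chains_above (Min (simplex_val \<chi> ` Poly_Mapping.keys c)) q k"
    using assms(1) by (auto simp: mem_simplices_superlevel subset_iff)
qed

lemma chain_val_frag_of: "chain_val \<chi> (frag_of \<sigma>) = ereal (simplex_val \<chi> \<sigma>)"
  by (simp add: chain_val_def keys_frag_of)

lemma emap_group_ring_act:
  assumes f: "emap R p i q b f" and "Poly_Mapping.keys r \<subseteq> carrier G" and c: "c \<in> chains p i"
  shows "f (group_ring_act G r c) = group_ring_act G r (f c)"
  using assms(2)
proof (induction r rule: frag_induction)
  case zero
  show ?case by (simp add: group_ring_act_def emap_zero[OF f])
next
  case (one g)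
  then show ?case by (simp add: group_ring_act_def emap_translate[OF f _ c])
next
  case (diff a b)
  then show ?case by (simp add: group_ring_act_def frag_extend_diff emap_diff[OF f])
qed

lemma emap_hom:
  assumes f: "emap R p i q b f"
  shows "f \<in> hom (vr_group (carrier G) d p i) (vr_group (carrier G) d q b)"
proof (rule homI)
  fix x y
  have "f (x - (0 - y)) = f x - (f 0 - f y)"
    by (simp only: emap_diff[OF f])
  then show "f (x \<otimes>\<^bsub>vr_group (carrier G) d p i\<^esub> y) = f x \<otimes>\<^bsub>vr_group (carrier G) d q b\<^esub> f y"
    by (simp add: emap_zero[OF f])
qed (rule emap_closed[OF f])

lemma cmap_imp_endomorphism:
  assumes \<phi>: "cmap \<delta> k (\<lambda>_. k) m \<phi>" and \<delta>: "0 < \<delta>"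
  shows "chain_endomorphism G S m k \<phi>" "extends_identity G S k \<phi>"
    "\<forall>q\<le>m. \<forall>c \<in> chains q k. c \<noteq> 0 \<longrightarrow> chain_val \<chi> (\<phi> q c) - chain_val \<chi> c > 0"
proof -
  show "chain_endomorphism G S m k \<phi>"
    unfolding chain_endomorphism_def ZG_endomorphism_def Let_def
  proof (intro conjI allI impI ballI)
    show "\<phi> q \<in> hom (vr_group (carrier G) d q k) (vr_group (carrier G) d q k)" if "q \<le> m" for q
      by (rule emap_hom[OF cmap_emap[OF \<phi> that]])
    show "\<phi> q (group_ring_act G r c) = group_ring_act G r (\<phi> q c)"
      if "q \<le> m" "r \<in> carrier (free_Abelian_group (carrier G))" "c \<in> chains q k" for q r c
      using emap_group_ring_act[OF cmap_emap[OF \<phi> that(1)] _ that(3), of r] that(2) by simp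
    show "boundary (Suc q) (\<phi> (Suc q) c) = \<phi> q (boundary (Suc q) c)"
      if "q < m" "c \<in> chains (Suc q) k" for q c
      by (rule cmap_boundary[OF \<phi> Suc_leI[OF that(1)] that(2)])
  qed
  show "extends_identity G S k \<phi>"
    unfolding extends_identity_def
    using cmap_boundary_0[OF \<phi>] augmentation_eq_iff emap_closed[OF cmap_emap[OF \<phi> le0]] by blast
  show "\<forall>q\<le>m. \<forall>c \<in> chains q k. c \<noteq> 0 \<longrightarrow> chain_val \<chi> (\<phi> q c) - chain_val \<chi> c > 0"
  proof (intro allI impI ballI)
    fix q c assume q: "q \<le> m" and c: "c \<in> chains q k" "c \<noteq> 0"
    obtain L where L: "chain_val \<chi> c = ereal L" "c \<in> chains_above L q k"
      using c by (rule chains_above_chain_val)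
    have "ereal (L + \<delta>) \<le> chain_val \<chi> (\<phi> q c)"
      by (rule chain_val_le[OF emap_above[OF cmap_emap[OF \<phi> q] L(2)]])
    then show "chain_val \<chi> (\<phi> q c) - chain_val \<chi> c > 0"
      using \<delta> L(1) by (cases "chain_val \<chi> (\<phi> q c)") auto
  qed
qed

text \<open>A positive gain on each simplex is a uniform gain, as there are finitely many orbits.\<close>

lemma endomorphism_imp_cmap:
  assumes endo: "chain_endomorphism G S m k \<phi>" and ext: "extends_identity G S k \<phi>"
    and gain: "\<forall>q\<le>m. \<forall>c \<in> chains q k. c \<noteq> 0 \<longrightarrow> chain_val \<chi> (\<phi> q c) - chain_val \<chi> c > 0"
  shows "\<exists>\<delta>>0. \<exists>\<psi>. cmap \<delta> k (\<lambda>_. k) m \<psi>"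
proof -
  define P where "P = (\<lambda>(q, x) \<delta>. \<phi> q (frag_of x) \<in> chains_above (simplex_val \<chi> x + \<delta>) q k)"
  have hom: "\<phi> q \<in> hom (vr_group (carrier G) d q k) (vr_group (carrier G) d q k)"
    and act: "\<And>r c. Poly_Mapping.keys r \<subseteq> carrier G \<Longrightarrow> c \<in> chains q k \<Longrightarrow>
      \<phi> q (group_ring_act G r c) = group_ring_act G r (\<phi> q c)" if "q \<le> m" for q
    using endo that by (auto simp: chain_endomorphism_def ZG_endomorphism_def Let_def)
  have closed: "\<phi> q c \<in> chains q k" if "q \<le> m" "c \<in> chains q k" for q c
    using hom[OF that(1)] that(2) by (rule hom_in_carrier)
  have "\<forall>z \<in> Sigma {..m} (\<lambda>q. base_simplices G S q k). eventually (P z) (at_right 0)"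
  proof
    fix z assume "z \<in> Sigma {..m} (\<lambda>q. base_simplices G S q k)"
    then obtain q x where z: "z = (q, x)" and q: "q \<le> m" and x: "x \<in> base_simplices G S q k"
      by auto
    have xc: "frag_of x \<in> chains q k"
      using base_simplexD(1)[OF x] by (simp add: keys_frag_of)
    show "eventually (P z) (at_right 0)"
    proof (cases "\<phi> q (frag_of x) = 0")
      case True
      then show ?thesis by (simp add: P_def z)
    next
      case False
      obtain L where L: "chain_val \<chi> (\<phi> q (frag_of x)) = ereal L" "\<phi> q (frag_of x) \<in> chains_above L q k"
        using closed[OF q xc] False by (rule chains_above_chain_val)
      have "chain_val \<chi> (\<phi> q (frag_of x)) - chain_val \<chi> (frag_of x) > 0"
        using gain q xc by simp
      then have pos: "0 < L - simplex_val \<chi> x"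
        by (simp add: L(1) chain_val_frag_of)
      have "P (q, x) \<delta>" if "\<delta> < L - simplex_val \<chi> x" for \<delta>
        unfolding P_def prod.case by (rule chains_above_antimono[OF L(2)]) (use that in auto)
      with pos show ?thesis
        unfolding eventually_at_right_field z by blast
    qed
  qed
  then have "eventually (\<lambda>\<delta>. \<forall>z \<in> Sigma {..m} (\<lambda>q. base_simplices G S q k). P z \<delta>) (at_right 0)"
    by (intro eventually_ball_finite) (use finite_base_simplices in auto)
  then obtain \<delta>' where \<delta>': "\<delta>' > 0" "\<And>\<delta>. 0 < \<delta> \<Longrightarrow> \<delta> < \<delta>' \<Longrightarrow>
      \<forall>z \<in> Sigma {..m} (\<lambda>q. base_simplices G S q k). P z \<delta>"
    unfolding eventually_at_right_field by blast
  define \<delta> where "\<delta> = \<delta>' / 2"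
  have P: "P (q, x) \<delta>" if "q \<le> m" "x \<in> base_simplices G S q k" for q x
    using \<delta>' that by (auto simp: \<delta>_def)
  have \<delta>: "0 < \<delta>" using \<delta>'(1) by (simp add: \<delta>_def)
  let ?\<psi> = "\<lambda>q. frag_extend (\<lambda>\<sigma>. \<phi> q (frag_of \<sigma>))"
  have eq: "?\<psi> q c = \<phi> q c" if "q \<le> m" "c \<in> chains q k" for q c
    using that(2)
  proof (induction rule: vr_chains_induct)
    case zero
    have "\<phi> q (0 - 0) = \<phi> q 0 - \<phi> q 0"
      by (rule hom_frag_diff[OF hom[OF that(1)]]) simp_all
    then show ?case by simp
  next
    case (diff a b)
    then show ?case
      using hom_frag_diff[OF hom[OF that(1)], of a b] by (simp add: frag_extend_diff)
  qed simp
  have "cmap \<delta> k (\<lambda>_. k) m ?\<psi>"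
    unfolding cmap_def
  proof (intro conjI allI impI ballI)
    fix q assume q: "q \<le> m"
    show "emap \<delta> q k q k (?\<psi> q)"
    proof (rule emapI)
      show "?\<psi> q (a - c) = ?\<psi> q a - ?\<psi> q c" for a c
        by (rule frag_extend_diff)
      show "?\<psi> q (frag_of x) \<in> chains_above (simplex_val \<chi> x + \<delta>) q k"
        if "x \<in> base_simplices G S q k" for x
        using P[OF q that] by (simp add: P_def)
      show "?\<psi> q (frag_of (map (\<lambda>y. g \<otimes> y) x)) = translate G g (?\<psi> q (frag_of x))"
        if x: "x \<in> base_simplices G S q k" and g: "g \<in> carrier G" for x g
        using act[OF q, of "frag_of g" "frag_of x"] g base_simplexD(1)[OF x]
        by (simp add: group_ring_act_def translate_frag_of keys_frag_of)
    qed
  next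
    fix q c assume q: "q < m" and c: "c \<in> chains (Suc q) k"
    have "boundary (Suc q) (\<phi> (Suc q) c) = \<phi> q (boundary (Suc q) c)"
      using endo q c unfolding chain_endomorphism_def by blast
    then show "boundary (Suc q) (?\<psi> (Suc q) c) = ?\<psi> q (boundary (Suc q) c)"
      using eq[OF Suc_leI[OF q] c] eq[OF less_imp_le[OF q] boundary_in_vr_chains[OF c]] by simp
  next
    fix c assume c: "c \<in> chains 0 k"
    have "augmentation (\<phi> 0 c) = augmentation c"
      using ext c unfolding extends_identity_def by blast
    then show "boundary 0 (?\<psi> 0 c) = boundary 0 c"
      using augmentation_eq_iff[OF closed[OF le0 c] c] eq[OF le0 c] by simp
  qed
  with \<delta> show ?thesis by blast
qed

section \<open>Runs of the algorithm\<close>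

lemma candidates_eq: "candidates G S \<chi> k t q x = chains_above (simplex_val \<chi> x + \<chi> t) q k"
proof -
  have "simplices (carrier G) d q k \<inter> lists (superlevel G \<chi> (\<chi> t + simplex_val \<chi> x)) =
      simplices (superlevel G \<chi> (simplex_val \<chi> x + \<chi> t)) d q k"
    by (auto simp: mem_simplices in_lists_conv_set superlevel_def add.commute)
  then show ?thesis by (simp add: candidates_def)
qed

lemma countable_chains_above: "countable (chains_above L q k)"
proof (rule countable_image_inj_on)
  let ?A = "lists (carrier G) \<times> (UNIV :: int set)"
  let ?graph = "\<lambda>c::'a vr_chain. (\<lambda>\<sigma>. (\<sigma>, Poly_Mapping.lookup c \<sigma>)) ` Poly_Mapping.keys c"
  have "countable {F. finite F \<and> F \<subseteq> ?A}"
    using countable_carrier by (intro countable_Collect_finite_subset) simp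
  moreover have "?graph ` chains_above L q k \<subseteq> {F. finite F \<and> F \<subseteq> ?A}"
    by (auto simp: mem_simplices subset_iff superlevel_def)
  ultimately show "countable (?graph ` chains_above L q k)"
    by (rule countable_subset[rotated])
  show "inj_on ?graph (chains_above L q k)"
  proof (rule inj_onI, rule poly_mapping_eqI)
    fix a b :: "'a vr_chain" and \<sigma>
    assume "?graph a = ?graph b"
    then have "\<sigma> \<in> Poly_Mapping.keys a \<and> v = Poly_Mapping.lookup a \<sigma> \<longleftrightarrow>
        \<sigma> \<in> Poly_Mapping.keys b \<and> v = Poly_Mapping.lookup b \<sigma>" for v
      by (auto simp: set_eq_iff image_iff)
    then show "Poly_Mapping.lookup a \<sigma> = Poly_Mapping.lookup b \<sigma>"
      by (metis in_keys_iff)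
  qed
qed

lemma enumeration_starting_at:
  assumes "countable A" "y \<in> A"
  shows "\<exists>e :: nat \<Rightarrow> _. range e = A \<and> e 0 = y"
proof (intro exI conjI)
  let ?e = "case_nat y (from_nat_into A)"
  have "range ?e = insert y (range (from_nat_into A))"
    by (force simp: image_iff split: nat.splits)
  then show "range ?e = A"
    using assms(2) range_from_nat_into[OF _ assms(1)] by (metis empty_iff insert_absorb)
qed simp

lemma algorithm_treats_simplices:
  assumes \<phi>: "cmap (\<chi> t) k (\<lambda>_. k) m \<phi>" and k: "k = Max (set ns)" and q: "Suc q \<le> m"
    and "finite X" "X \<subseteq> base_simplices G S (Suc q) k"
    and "\<forall>x \<in> base_simplices G S q k. V q x = \<phi> q (frag_of x)"
  shows "\<exists>V'. (algorithm_step G S m ns \<chi>)\<^sup>*\<^sup>* (Running t (Suc q) X V) (Running t (Suc q) {} V') \<and>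
    (\<forall>x. V' (Suc q) x = (if x \<in> X then \<phi> (Suc q) (frag_of x) else V (Suc q) x))"
  using assms(4-6)
proof (induction X arbitrary: V rule: finite_induct)
  case empty
  then show ?case by auto
next
  case (insert x X)
  let ?y = "\<phi> (Suc q) (frag_of x)"
  let ?V = "V(Suc q := (V (Suc q))(x := ?y))"
  have x: "x \<in> base_simplices G S (Suc q) k" using insert.prems by simp
  have xc: "frag_of x \<in> chains (Suc q) k"
    using base_simplexD(1)[OF x] by (simp add: keys_frag_of)
  have "?y \<in> candidates G S \<chi> k t (Suc q) x"
    unfolding candidates_eq by (rule emap_base[OF cmap_emap[OF \<phi> q] x])
  then obtain e :: "nat \<Rightarrow> _" where e: "range e = candidates G S \<chi> k t (Suc q) x" "e 0 = ?y"
    using enumeration_starting_at[OF countable_chains_above] unfolding candidates_eq by metis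
  have "linear_extension G (V q) (boundary (Suc q) (frag_of x)) = \<phi> q (boundary (Suc q) (frag_of x))"
    by (rule emap_linear_extension_cong[OF _ cmap_emap[OF \<phi> Suc_leD[OF q]] boundary_in_vr_chains[OF xc]])
      (use insert.prems in simp)
  then have "boundary (Suc q) ?y = linear_extension G (V q) (boundary (Suc q) (frag_of x))"
    using cmap_boundary[OF \<phi> q xc] by simp
  then have find: "find (\<lambda>y. boundary (Suc q) y =
      linear_extension G (V (Suc q - 1)) (boundary (Suc q) (frag_of x))) (map e [0..<1]) = Some ?y"
    by (simp add: e(2))
  have "algorithm_step G S m ns \<chi> (Running t (Suc q) (insert x X) V)
      (Running t (Suc q) (insert x X - {x}) ?V)"
    using algorithm_step.found[where \<phi> = V, OF insertI1 e(1)[unfolded k] find] .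
  moreover have "insert x X - {x} = X" using insert.hyps by simp
  ultimately have step: "algorithm_step G S m ns \<chi> (Running t (Suc q) (insert x X) V)
      (Running t (Suc q) X ?V)"
    by simp
  have "X \<subseteq> base_simplices G S (Suc q) k" "\<forall>x \<in> base_simplices G S q k. ?V q x = \<phi> q (frag_of x)"
    using insert.prems by simp_all
  from insert.IH[where V = ?V, OF this] obtain V' where
    V': "(algorithm_step G S m ns \<chi>)\<^sup>*\<^sup>* (Running t (Suc q) X ?V) (Running t (Suc q) {} V')"
      "\<forall>z. V' (Suc q) z = (if z \<in> X then \<phi> (Suc q) (frag_of z) else ?V (Suc q) z)"
    by blast
  from step V'(1) have "(algorithm_step G S m ns \<chi>)\<^sup>*\<^sup>*
      (Running t (Suc q) (insert x X) V) (Running t (Suc q) {} V')"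
    by (rule converse_rtranclp_into_rtranclp)
  moreover have "\<forall>z. V' (Suc q) z =
      (if z \<in> insert x X then \<phi> (Suc q) (frag_of z) else V (Suc q) z)"
    using V'(2) by simp
  ultimately show ?case by blast
qed

lemma algorithm_complete:
  assumes \<phi>: "cmap (\<chi> t) k (\<lambda>_. k) m \<phi>" and \<phi>0: "\<phi> 0 = vertex_map t"
    and k: "k = Max (set ns)" and t: "t \<in> carrier G" "0 < \<chi> t"
  shows "algorithm_outputs G S m ns \<chi> Yes"
proof -
  have "\<exists>V. (algorithm_step G S m ns \<chi>)\<^sup>*\<^sup>* Start (Running t q {} V) \<and>
      (\<forall>x \<in> base_simplices G S q k. V q x = \<phi> q (frag_of x))" if "q \<le> m" for q
    using that
  proof (induction q)
    case 0
    let ?V = "(\<lambda>_ _. 0)(0 := vertex_value t)"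
    have "algorithm_step G S m ns \<chi> Start (Running t 0 {} ?V)"
      using t by (rule algorithm_step.pick)
    moreover have "?V 0 x = \<phi> 0 (frag_of x)" if "x \<in> base_simplices G S 0 k" for x
      using vertex_map_base[OF t(1) that] base_simplices_0[OF that] unfolding \<phi>0 by simp
    ultimately show ?case by blast
  next
    case (Suc q)
    then obtain V where V: "(algorithm_step G S m ns \<chi>)\<^sup>*\<^sup>* Start (Running t q {} V)"
      "\<forall>x \<in> base_simplices G S q k. V q x = \<phi> q (frag_of x)"
      by auto
    have step: "algorithm_step G S m ns \<chi> (Running t q {} V)
        (Running t (Suc q) (base_simplices G S (Suc q) k) V)"
      unfolding k using Suc.prems by (intro algorithm_step.next_degree) simp
    from algorithm_treats_simplices[where V = V, OF \<phi> k Suc.prems finite_base_simplices order_refl V(2)]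
    obtain V' where "(algorithm_step G S m ns \<chi>)\<^sup>*\<^sup>*
        (Running t (Suc q) (base_simplices G S (Suc q) k) V) (Running t (Suc q) {} V')"
      "\<forall>x \<in> base_simplices G S (Suc q) k. V' (Suc q) x = \<phi> (Suc q) (frag_of x)"
      by auto
    with rtranclp.rtrancl_into_rtrancl[OF V(1) step] show ?case
      by (meson rtranclp_trans)
  qed
  from this[OF order_refl] obtain V where
    "(algorithm_step G S m ns \<chi>)\<^sup>*\<^sup>* Start (Running t m {} V)"
    by blast
  then show ?thesis
    unfolding algorithm_outputs_def
    using algorithm_step.finish by (rule rtranclp.rtrancl_into_rtrancl)
qed

definition valid_run ::
    "nat \<Rightarrow> real \<Rightarrow> 'a \<Rightarrow> nat \<Rightarrow> 'a list set \<Rightarrow> (nat \<Rightarrow> 'a list \<Rightarrow> 'a vr_chain) \<Rightarrow> bool" where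
  "valid_run m k t q X V \<longleftrightarrow>
     t \<in> carrier G \<and> 0 < \<chi> t \<and> q \<le> m \<and> (q = 0 \<longrightarrow> X = {}) \<and> V 0 = vertex_value t \<and>
     (\<forall>p\<le>q. \<forall>x \<in> base_simplices G S p k. p < q \<or> x \<notin> X \<longrightarrow>
        V p x \<in> chains_above (simplex_val \<chi> x + \<chi> t) p k \<and>
        (0 < p \<longrightarrow> boundary p (V p x) = linear_extension G (V (p - 1)) (boundary p (frag_of x))))"

lemma valid_run_found:
  assumes valid: "valid_run m k t q X V" and x: "x \<in> X"
    and y: "y \<in> chains_above (simplex_val \<chi> x + \<chi> t) q k"
      "boundary q y = linear_extension G (V (q - 1)) (boundary q (frag_of x))"
  shows "valid_run m k t q (X - {x}) (V(q := (V q)(x := y)))"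
proof -
  have q: "0 < q" using valid x by (auto simp: valid_run_def)
  show ?thesis
    using valid y q unfolding valid_run_def
    by (auto simp del: carrier_free_Abelian_group_iff)
qed

lemma valid_run_step:
  assumes k: "k = Max (set ns)" "0 \<le> k" and "algorithm_step G S m ns \<chi> s s'"
    and "case s of Running t q X V \<Rightarrow> valid_run m k t q X V | _ \<Rightarrow> True"
  shows "case s' of Start \<Rightarrow> True | Running t q X V \<Rightarrow> valid_run m k t q X V
    | Halted a \<Rightarrow> a = Yes \<longrightarrow> (\<exists>t V. valid_run m k t m {} V)"
  using assms(3,4)
proof cases
  case (pick t)
  then show ?thesis
    using vertex_value_above[OF pick(3) k(2)]
    by (simp add: valid_run_def del: carrier_free_Abelian_group_iff)
next
  case (next_degree q t V)
  then show ?thesis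
    using assms(4) by (auto simp: valid_run_def k(1) le_Suc_eq simp del: carrier_free_Abelian_group_iff)
next
  case (found x X e t q V N y)
  have "y \<in> range e"
    and y: "boundary q y = linear_extension G (V (q - 1)) (boundary q (frag_of x))"
    using found(5) by (auto simp: find_Some_iff)
  then have "y \<in> chains_above (simplex_val \<chi> x + \<chi> t) q k"
    using found(4) unfolding candidates_eq k(1) by simp
  with assms(4) found(1) have "valid_run m k t q (X - {x}) (V(q := (V q)(x := y)))"
    by (intro valid_run_found[where V = V, OF _ found(3) _ y]) simp_all
  then show ?thesis using found(2) by simp
next
  case (finish t V)
  then show ?thesis using assms(4) by auto
qed simp

lemma valid_run_imp_cmap:
  assumes valid: "valid_run m k t m {} V" and k: "0 \<le> k"
  shows "cmap (\<chi> t) k (\<lambda>_. k) m (\<lambda>p. linear_extension G (V p))"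
proof -
  have t: "t \<in> carrier G" and V0: "V 0 = vertex_value t"
    using valid by (auto simp: valid_run_def)
  have above: "V p x \<in> chains_above (simplex_val \<chi> x + \<chi> t) p k"
    if "p \<le> m" "x \<in> base_simplices G S p k" for p x
    using valid that unfolding valid_run_def by (metis empty_iff)
  have bd: "boundary (Suc p) (V (Suc p) x) = linear_extension G (V p) (boundary (Suc p) (frag_of x))"
    if "p < m" "x \<in> base_simplices G S (Suc p) k" for p x
    using valid that unfolding valid_run_def by (metis Suc_leI diff_Suc_1 empty_iff zero_less_Suc)
  have em: "emap (\<chi> t) p k p k (linear_extension G (V p))" if "p \<le> m" for p
    by (rule emap_linear_extension(1)) (rule above[OF that])
  show ?thesis
    unfolding cmap_def
  proof (intro conjI allI impI ballI)
    show "emap (\<chi> t) p k p k (linear_extension G (V p))" if "p \<le> m" for p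
      by (rule em[OF that])
    show "boundary (Suc p) (linear_extension G (V (Suc p)) c) =
        linear_extension G (V p) (boundary (Suc p) c)"
      if p: "p < m" and c: "c \<in> chains (Suc p) k" for p c
    proof (rule emap_eqI[OF _ _ _ c])
      note F = emap_comp[OF emap_boundary em[OF less_imp_le[OF p]]]
      fix x g assume x: "x \<in> base_simplices G S (Suc p) k" and g: "g \<in> carrier G"
      show "boundary (Suc p) (linear_extension G (V (Suc p)) (frag_of (map (\<lambda>y. g \<otimes> y) x))) =
          linear_extension G (V p) (boundary (Suc p) (frag_of (map (\<lambda>y. g \<otimes> y) x)))"
        using emap_frag_of_translate[OF F x g]
        by (simp only: linear_extension_translate_base[OF x g] boundary_translate bd[OF p x])
    qed (simp_all only: linear_extension_diff boundary_diff)
    show "boundary 0 (linear_extension G (V 0) c) = boundary 0 c" if "c \<in> chains 0 k" for c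
      using cmap_boundary_0[OF cmap_vertex_map[where s = "\<lambda>_. 0", OF t order_refl] that]
      unfolding V0 .
  qed
qed

lemma algorithm_sound:
  assumes k: "k = Max (set ns)" "0 \<le> k" and "algorithm_outputs G S m ns \<chi> Yes"
  shows "\<exists>\<delta>>0. \<exists>\<phi>. cmap \<delta> k (\<lambda>_. k) m \<phi>"
proof -
  let ?P = "\<lambda>s. case s of Start \<Rightarrow> True | Running t q X V \<Rightarrow> valid_run m k t q X V
    | Halted a \<Rightarrow> a = Yes \<longrightarrow> (\<exists>t V. valid_run m k t m {} V)"
  have "?P s" if "(algorithm_step G S m ns \<chi>)\<^sup>*\<^sup>* Start s" for s
    using that
  proof (induction rule: rtranclp_induct)
    case (step s s')
    have "case s of Running t q X V \<Rightarrow> valid_run m k t q X V | _ \<Rightarrow> True"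
      using step.IH by (cases s) auto
    from valid_run_step[OF k step.hyps(2) this] show ?case .
  qed simp
  from this[of "Halted Yes"] assms(3) obtain t V where valid: "valid_run m k t m {} V"
    unfolding algorithm_outputs_def by auto
  then have "0 < \<chi> t" by (simp add: valid_run_def)
  with valid_run_imp_cmap[OF valid k(2)] show ?thesis by blast
qed

lemma positive_letter:
  assumes "\<exists>g \<in> carrier G. \<chi> g \<noteq> 0"
  obtains t where "t \<in> letters" "0 < \<chi> t"
proof -
  have "\<exists>t \<in> letters. 0 < \<chi> t"
  proof (rule ccontr)
    assume "\<not> (\<exists>t \<in> letters. 0 < \<chi> t)"
    then have le: "\<chi> t \<le> 0" if "t \<in> letters" for t
      using that by (meson not_le)
    have S0: "\<chi> s = 0" if "s \<in> S" for s
      using le[of s] le[of "inv s"] that S_subset character_inv[of s] by auto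
    have "\<chi> g = 0" if "g \<in> generate G S" for g
      using that
    proof (induction rule: generate.induct)
      case (eng h1 h2)
      then show ?case by (simp add: generate_S character_mult)
    qed (use S0 S_subset in \<open>auto simp: character_one character_inv subset_iff\<close>)
    with assms show False unfolding generate_S by blast
  qed
  then show thesis using that by blast
qed

lemma Sigma_criterion:
  assumes nz: "\<exists>g \<in> carrier G. \<chi> g \<noteq> 0"
    and \<mu>: "\<And>q a. q < m \<Longrightarrow> 0 \<le> a \<Longrightarrow> homology_vanishes (carrier G) d q a (\<mu> a)"
    and van: "\<And>q. q < m \<Longrightarrow> homology_vanishes (carrier G) d q (n q) (n (Suc q))"
    and n: "0 \<le> n 0" "\<And>q. q < m \<Longrightarrow> (\<mu> ^^ Suc q) (n q) \<le> n (Suc q)"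
    and mono: "\<And>p q. p \<le> q \<Longrightarrow> q \<le> m \<Longrightarrow> n p \<le> n q"
    and k: "k = Max (set ns)" "1 \<le> k" "\<And>q. q \<le> m \<Longrightarrow> n q \<le> k"
  shows "\<chi> \<in> Sigma_inv G S m \<longleftrightarrow> algorithm_outputs G S m ns \<chi> Yes"
    and "\<chi> \<in> Sigma_inv G S m \<longleftrightarrow>
      (\<exists>\<phi>. chain_endomorphism G S m k \<phi> \<and> extends_identity G S k \<phi> \<and>
        (\<forall>q\<le>m. \<forall>c \<in> chains q k. c \<noteq> 0 \<longrightarrow> chain_val \<chi> (\<phi> q c) - chain_val \<chi> c > 0))"
    (is "_ \<longleftrightarrow> ?endo")
proof -
  let ?raise = "\<exists>\<delta>>0. \<exists>\<phi>. cmap \<delta> k (\<lambda>_. k) m \<phi>"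
  have 1: "algorithm_outputs G S m ns \<chi> Yes" if "\<chi> \<in> Sigma_inv G S m"
  proof -
    obtain t where t: "t \<in> letters" "0 < \<chi> t"
      using nz by (rule positive_letter)
    have FP: "type_FP m (superlevel G \<chi> 0) d" using that by (simp add: Sigma_inv_def)
    have "\<exists>\<phi>. cmap (\<chi> t) k (\<lambda>_. k) m \<phi> \<and> \<phi> 0 = vertex_map t"
      by (rule exists_raising_cmap[OF FP t \<mu> van n mono k(2,3)])
    then show ?thesis
      using algorithm_complete[OF _ _ k(1) _ t(2)] t(1) letters_subset by blast
  qed
  have 2: ?raise if "algorithm_outputs G S m ns \<chi> Yes"
    using algorithm_sound[OF k(1) _ that] k(2) by simp
  have 3: ?endo if ?raise
    using that cmap_imp_endomorphism by blast
  have 4: ?raise if ?endo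
    using that endomorphism_imp_cmap by blast
  have 5: "\<chi> \<in> Sigma_inv G S m" if ?raise
    using that type_FP_superlevel[OF _ _ van n(1) k(3)] character by (auto simp: Sigma_inv_def)
  show "\<chi> \<in> Sigma_inv G S m \<longleftrightarrow> algorithm_outputs G S m ns \<chi> Yes"
    using 1 2 5 by blast
  show "\<chi> \<in> Sigma_inv G S m \<longleftrightarrow> ?endo"
    using 1 2 3 4 5 by blast
qed

end

theorem theorem3:
  fixes G :: "('a, 'b) monoid_scheme" and S :: "'a set" and m :: nat
  assumes "group G"
    and "finite S" and "S \<subseteq> carrier G" and "generate G S = carrier G"
    and "type_FP m (carrier G) (word_dist G S)"
    and "solvable_word_problem G S"
  shows "\<exists>ns k. connecting_vector G S m ns \<and> k = Max (set ns) \<and> 0 \<le> k \<and>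
    (\<forall>\<chi> \<in> hom G real_add_group. (\<exists>g \<in> carrier G. \<chi> g \<noteq> 0) \<longrightarrow>
      (\<chi> \<in> Sigma_inv G S m \<longleftrightarrow>
        (\<exists>\<phi>. chain_endomorphism G S m k \<phi> \<and> extends_identity G S k \<phi> \<and>
          (\<forall>q\<le>m. \<forall>c \<in> vr_chains (carrier G) (word_dist G S) q k.
             c \<noteq> 0 \<longrightarrow> chain_val \<chi> (\<phi> q c) - chain_val \<chi> c > 0))) \<and>
      (\<chi> \<in> Sigma_inv G S m \<longleftrightarrow> algorithm_outputs G S m ns \<chi> Yes))"
proof -
  let ?d = "word_dist G S"
  have "\<exists>j. 0 \<le> i \<longrightarrow> i \<le> j \<and> (\<forall>q<m. homology_vanishes (carrier G) ?d q i j)" for i :: real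
  proof (cases "0 \<le> i")
    case True
    have "\<forall>q \<in> {..<m}. eventually (\<lambda>j. homology_vanishes (carrier G) ?d q i j) at_top"
    proof
      fix q assume "q \<in> {..<m}"
      with assms(5) True obtain j where "homology_vanishes (carrier G) ?d q i j"
        unfolding type_FP_def by blast
      then have "homology_vanishes (carrier G) ?d q i j'" if "j \<le> j'" for j'
        using homology_vanishes_mono that by blast
      then show "eventually (\<lambda>j. homology_vanishes (carrier G) ?d q i j) at_top"
        unfolding eventually_at_top_linorder by blast
    qed
    then have "eventually (\<lambda>j. \<forall>q \<in> {..<m}. homology_vanishes (carrier G) ?d q i j) at_top"
      by (intro eventually_ball_finite) auto
    then have "eventually (\<lambda>j. i \<le> j \<and> (\<forall>q \<in> {..<m}. homology_vanishes (carrier G) ?d q i j)) at_top"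
      using eventually_ge_at_top by (rule eventually_conj[rotated])
    then show ?thesis
      unfolding eventually_at_top_linorder by blast
  qed simp
  then obtain \<mu> where \<mu>: "0 \<le> i \<Longrightarrow> i \<le> \<mu> i"
    "0 \<le> i \<Longrightarrow> q < m \<Longrightarrow> homology_vanishes (carrier G) ?d q i (\<mu> i)" for i q
    by metis
  have \<mu>_funpow: "i \<le> (\<mu> ^^ l) i" if "0 \<le> i" for i l
    by (induction l) (use \<mu>(1) that order_trans in \<open>auto intro: order_trans\<close>)
  define n where "n = rec_nat 1 (\<lambda>q. \<mu> ^^ Suc q)"
  have n0: "n 0 = 1" and nSuc: "n (Suc q) = (\<mu> ^^ Suc q) (n q)" for q
    by (simp_all add: n_def)
  have n1: "1 \<le> n q" for q
  proof (induction q)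
    case (Suc q)
    then show ?case using \<mu>_funpow[of "n q" "Suc q"] unfolding nSuc by linarith
  qed (simp add: n0)
  have n_nonneg: "0 \<le> n q" for q
    using n1[of q] by simp
  have mono: "n p \<le> n q" if "p \<le> q" for p q
    using that
  proof (rule lift_Suc_mono_le[rotated])
    show "n q \<le> n (Suc q)" for q
      unfolding nSuc by (rule \<mu>_funpow[OF n_nonneg])
  qed
  have van: "homology_vanishes (carrier G) ?d q (n q) (n (Suc q))" if "q < m" for q
  proof -
    have "homology_vanishes (carrier G) ?d q ((\<mu> ^^ q) (n q)) (\<mu> ((\<mu> ^^ q) (n q)))"
      using \<mu>_funpow[OF n_nonneg[of q], of q] n_nonneg[of q] that by (intro \<mu>(2)) auto
    then show ?thesis
      using homology_vanishes_mono[OF _ \<mu>_funpow[OF n_nonneg[of q], of q] order_refl]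
      by (simp add: nSuc)
  qed
  define ns where "ns = map n [0..<Suc m]"
  have set_ns: "set ns = n ` {..m}"
    by (auto simp: ns_def simp del: upt_Suc)
  define k where "k = Max (set ns)"
  have nk: "n q \<le> k" if "q \<le> m" for q
    unfolding k_def set_ns using that by (intro Max_ge) auto
  have k1: "1 \<le> k" using nk[of 0] n0 by simp
  have ns_nth: "ns ! q = n q" if "q \<le> m" for q
    unfolding ns_def using that by (simp del: upt_Suc)
  have vector: "connecting_vector G S m ns"
    unfolding connecting_vector_def
    using van n_nonneg by (auto simp: set_ns ns_nth) (simp add: ns_def)
  have main: "(\<chi> \<in> Sigma_inv G S m \<longleftrightarrow>
        (\<exists>\<phi>. chain_endomorphism G S m k \<phi> \<and> extends_identity G S k \<phi> \<and>
          (\<forall>q\<le>m. \<forall>c \<in> vr_chains (carrier G) ?d q k.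
             c \<noteq> 0 \<longrightarrow> chain_val \<chi> (\<phi> q c) - chain_val \<chi> c > 0))) \<and>
      (\<chi> \<in> Sigma_inv G S m \<longleftrightarrow> algorithm_outputs G S m ns \<chi> Yes)"
    if "\<chi> \<in> hom G real_add_group" "\<exists>g \<in> carrier G. \<chi> g \<noteq> 0" for \<chi>
  proof -
    interpret character_group G S \<chi>
      by (intro character_group.intro fg_group.intro fg_group_axioms.intro
          character_group_axioms.intro assms that)
    note crit = Sigma_criterion[of m \<mu> n k ns, OF that(2) \<mu>(2) van n_nonneg _ mono k_def k1 nk]
    show ?thesis
      by (intro conjI crit) (simp_all only: nSuc order_refl)
  qed
  show ?thesis
    by (intro exI[of _ ns] exI[of _ k] conjI vector k_def ballI impI main) (use k1 in auto)
qed

end
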